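(* Consider the global beeping model. For any positive integer constant $n$ ($n\geq 2$) there exists a positive integer $c$ such that Algorithm Fast-bounded-energy-RV-with-detection (with parameter $n$) can be executed by $c$-bounded agents in any graph of size at most $n$. If two such agents with distinct labels execute this algorithm in such a graph, then they meet and simultaneously declare rendezvous (they are at the same node and declare rendezvous in the same round) in time $O(\log\ell)$ after the start of the later agent, where $\ell$ is the smaller label (and the constant hidden in $O$ may depend on $n$). This time is optimal, even in the two-node graph: any deterministic algorithm of rendezvous with detection in the global beeping model on the two-node graph must take time $\Omega(\log\ell)$, where $\ell$ is the smaller label; that is, there is a constant $\kappa>0$ such that for every such algorithm there are infinitely many integers $\ell$ for which some execution with smaller label $\ell$ takes time at least $\kappa\log\ell$.
   Context: **Graphs.** A graph is a simple connected undirected graph with at least two nodes and unlabeled nodes; its size is its number of nodes. The edges incident to a node of degree $d$ have distinct port numbers $0,\dots,d-1$ at that node; there is no relation between the two port numbers of an edge at its two endpoints. The two-node graph is a single edge. **Agents.** Two agents executing the same deterministic algorithm have distinct labels that are positive integers. Each agent knows its own label but not the other's, and does not know the graph or the other agent's starting node or activation round. An adversary chooses the starting nodes and the (possibly different) activation rounds; each agent appears at its starting node when activated, and the activation round is its round 1. Time proceeds in synchronous rounds. In each round an agent stays at its node or moves through a chosen port to a neighbor; its node in that round is the one reached after this action. On entering a node it learns the degree and the port of entry. In each round an agent also either beeps or listens. An agent's decision in a round depends only on its label and its own history since activation. A $c$-bounded agent can perform at most $c$ moves (edge traversals) in total; beeps are not restricted. **Global beeping model.** If an agent listens in a round and the other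 agent (already activated) beeps in this round, then it hears a loud beep if the other agent is at the same node and a soft beep if the other agent is at a different node. Otherwise it hears nothing. **Rendezvous with detection** means that both agents are at the same node, declare rendezvous in the same round, and stop. The time of an execution is the number of rounds from the activation of the later agent to the declaration. $\log\ell$ stands for the length of the binary representation of $\ell$ (so it is at least $1$). **Label transformation.** Let $(c_1\dots c_k)$ be the binary representation of $L$. $T_1(L)$ is the binary sequence $(01c_1c_1c_2c_2\dots c_kc_k01)$, and $T_2(L)$ is obtained from $T_1(L)$ by replacing each bit $0$ by $(00)$ and each bit $1$ by $(10)$. **Procedure Symmetry-breaking** (label $L$; called upon activation; no moves). Let $T_2(L)=(d_1\dots d_s)$. In consecutive rounds $i=1,2,\dots$ (counted since your wake-up), until you hear a beep: if $i\le s$ and $d_i=1$ then beep, else listen. Let $r$ be the round when you first hear a beep. If you beeped in round $r-1$, then declare round $r+1$ red and set $role:=waiting$. Otherwise beep in round $r+1$, declare round $r+2$ red and set $role:=walking$. If the beep you heard was loud, declare rendezvous in the red round and stop. **Exploration procedure $EXP(m)$.** There is a fixed infinite sequence $x_1,x_2,\dots$ of non-negative integers (a universal exploration sequence) and a polynomial $R$ such that the following walk of $R(m)$ steps visits all nodes of any graph of size at most $m$, from any starting node: in step 1 leave by port $0$; if in step $i\ge1$ the agent entered a node of degree $d$ by port $p$, then in step $i+1$ it leaves by port $(p+x_i)\bmod d$. **Procedure Modified-beeping-exploration$(n)$.** Replace each round of $EXP(n)$ by two consecutive rounds: if in that round of $EXP(n)$ the agent takes port $p$ to move to node $u$, then in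 the first of the two rounds it takes port $p$ to move to $u$ and beeps, and in the second it stays at $u$ and listens. **Algorithm Fast-bounded-energy-RV-with-detection** (label $L$, parameter $n$). Perform Procedure Symmetry-breaking. If (not stopped and) $role=waiting$: stay idle and listen until you hear a loud beep; let $t$ be the round when you first hear a loud beep; beep in round $t+1$, declare rendezvous in round $t+2$, and stop. If $role=walking$: perform Modified-beeping-exploration$(n)$ starting in the red round, until you hear a loud beep; let $t$ be the round when you first hear a loud beep; (staying idle) declare rendezvous in round $t+1$, and stop. *)

theory Defs
  imports
    "Graph_Theory.Graph_Theory"
    "HOL-Computational_Algebra.Polynomial"
    Complex_Main
begin

section \<open>Port-numbered graphs\<close>

text \<open>
  Nodes are natural numbers, which loses no generality for finite graphs; agents never see them.
  An undirected edge is a pair of opposite arcs, and \<open>port P v w\<close> is the port number at \<open>v\<close> of the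
  edge joining \<open>v\<close> and \<open>w\<close>.
\<close>

record port_graph =
  graph_of :: "nat pair_pre_digraph"
  port :: "nat \<Rightarrow> nat \<Rightarrow> nat"

abbreviation nodes :: "port_graph \<Rightarrow> nat set" where
  "nodes P \<equiv> pverts (graph_of P)"

definition deg :: "port_graph \<Rightarrow> nat \<Rightarrow> nat" where
  "deg P v = out_degree (with_proj (graph_of P)) v"

definition is_port_graph :: "port_graph \<Rightarrow> bool" where
  "is_port_graph P \<longleftrightarrow>
     pair_graph (graph_of P) \<and> connected (with_proj (graph_of P)) \<and> card (nodes P) \<ge> 2 \<and>
     (\<forall>v\<in>nodes P. bij_betw (port P v) {w. (v, w) \<in> parcs (graph_of P)} {..<deg P v})"

definition nbr :: "port_graph \<Rightarrow> nat \<Rightarrow> nat \<Rightarrow> nat" where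
  "nbr P v p = (THE w. (v, w) \<in> parcs (graph_of P) \<and> port P v w = p)"

definition two_node_graph :: port_graph where
  "two_node_graph =
     \<lparr>graph_of = \<lparr>pverts = {0, 1}, parcs = {(0, 1), (1, 0)}\<rparr>, port = (\<lambda>_ _. 0)\<rparr>"

lemma out_arcs_two_node_graph:
  "out_arcs (with_proj (graph_of two_node_graph)) 0 = {(0, 1)}"
  "out_arcs (with_proj (graph_of two_node_graph)) (Suc 0) = {(1, 0)}"
  by (auto simp: two_node_graph_def)

lemma is_port_graph_two_node_graph: "is_port_graph two_node_graph"
proof -
  have pg: "pair_graph (graph_of two_node_graph)"
    by unfold_locales (auto simp: two_node_graph_def symmetric_def sym_def)
  have ps: "parcs (mk_symmetric (with_proj (graph_of two_node_graph))) = {(0, 1), (1, 0)}"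
    by (auto simp: parcs_mk_symmetric two_node_graph_def)
  have conn: "connected (with_proj (graph_of two_node_graph))"
    unfolding connected_def
  proof (rule strongly_connectedI)
    show "verts (with_proj (mk_symmetric (with_proj (graph_of two_node_graph)))) \<noteq> {}"
      by (simp add: two_node_graph_def)
  next
    fix u v
    assume "u \<in> verts (with_proj (mk_symmetric (with_proj (graph_of two_node_graph))))"
      "v \<in> verts (with_proj (mk_symmetric (with_proj (graph_of two_node_graph))))"
    then show "u \<rightarrow>\<^sup>*\<^bsub>with_proj (mk_symmetric (with_proj (graph_of two_node_graph)))\<^esub> v"
      unfolding reachable_def with_proj_simps ps
      by (auto simp: two_node_graph_def intro: rtrancl_on_refl rtrancl_on_into_rtrancl_on)
  qed
  have "bij_betw (port two_node_graph v) {w. (v, w) \<in> parcs (graph_of two_node_graph)}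
          {..<deg two_node_graph v}" if "v \<in> nodes two_node_graph" for v
    using that out_arcs_two_node_graph
    by (auto simp: deg_def out_degree_def two_node_graph_def bij_betw_def)
  then show ?thesis
    using pg conn by (auto simp: is_port_graph_def two_node_graph_def)
qed


section \<open>Agents and executions in the global beeping model\<close>

text \<open>An action \<open>Action None b d\<close> stays at the current node.\<close>

datatype action = Action (move: "nat option") (beeps: bool) (declares: bool)

datatype sound = Silence | Soft | Loud

text \<open>
  What an agent knows about one of its rounds: its own action, the degree of the node and the port
  of entry if it entered a node in this round, and what it heard.
\<close>

datatype observation =
  Obs (act: action) (entered: "(nat \<times> nat) option") (heard: sound)

type_synonym history = "observation list"

text \<open>
  The arguments of an algorithm are the label, the degree of the starting node, and the history
  of the rounds since activation, oldest first.
\<close>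

type_synonym algorithm = "nat \<Rightarrow> nat \<Rightarrow> history \<Rightarrow> action"

record agent =
  lbl :: nat
  start :: nat
  wake :: nat

record agent_state =
  pos :: nat
  hist :: history

definition stopped :: "agent_state \<Rightarrow> bool" where
  "stopped s \<longleftrightarrow> (\<exists>e\<in>set (hist s). declares (act e))"

definition active :: "nat \<Rightarrow> agent \<Rightarrow> agent_state \<Rightarrow> bool" where
  "active t A s \<longleftrightarrow> wake A \<le> t \<and> \<not> stopped s"

definition choice :: "algorithm \<Rightarrow> port_graph \<Rightarrow> nat \<Rightarrow> agent \<Rightarrow> agent_state \<Rightarrow> action" where
  "choice alg P t A s =
     (if active t A s then alg (lbl A) (deg P (start A)) (hist s) else Action None False False)"

text \<open>Choosing a port number that does not exist at the current node means staying there.\<close>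

definition traverses :: "port_graph \<Rightarrow> nat \<Rightarrow> action \<Rightarrow> bool" where
  "traverses P v a \<longleftrightarrow> (\<exists>p < deg P v. move a = Some p)"

definition target :: "port_graph \<Rightarrow> nat \<Rightarrow> action \<Rightarrow> nat" where
  "target P v a = (if traverses P v a then nbr P v (the (move a)) else v)"

text \<open>The state of \<open>A\<close> after round \<open>t\<close>, where \<open>s\<close> and \<open>s'\<close> are the states of \<open>A\<close> and of the
  other agent \<open>B\<close> before that round.\<close>

definition step ::
  "algorithm \<Rightarrow> port_graph \<Rightarrow> nat \<Rightarrow> agent \<Rightarrow> agent_state \<Rightarrow> agent \<Rightarrow> agent_state \<Rightarrow> agent_state"
where
  "step alg P t A s B s' =
     (let a = choice alg P t A s; b = choice alg P t B s';
          u = target P (pos s) a; w = target P (pos s') b;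
          info = (if traverses P (pos s) a then Some (deg P u, port P u (pos s)) else None);
          sd = (if beeps a \<or> \<not> beeps b then Silence else if u = w then Loud else Soft)
      in if active t A s then \<lparr>pos = u, hist = hist s @ [Obs a info sd]\<rparr> else s)"

text \<open>The states of the two agents before the global round \<open>t\<close>; global rounds are
  \<open>0, 1, 2, \<dots>\<close>, and \<open>wake\<close> is the global round of activation.\<close>

primrec run ::
  "algorithm \<Rightarrow> port_graph \<Rightarrow> agent \<Rightarrow> agent \<Rightarrow> nat \<Rightarrow> agent_state \<times> agent_state"
where
  "run alg P A B 0 = (\<lparr>pos = start A, hist = []\<rparr>, \<lparr>pos = start B, hist = []\<rparr>)"
| "run alg P A B (Suc t) =
     (let (s, s') = run alg P A B t in (step alg P t A s B s', step alg P t B s' A s))"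

definition moves :: "agent_state \<Rightarrow> nat" where
  "moves s = length (filter (\<lambda>e. entered e \<noteq> None) (hist s))"

definition moves_bounded :: "algorithm \<Rightarrow> port_graph \<Rightarrow> agent \<Rightarrow> agent \<Rightarrow> nat \<Rightarrow> bool" where
  "moves_bounded alg P A B c \<longleftrightarrow>
     (\<forall>t. moves (fst (run alg P A B t)) \<le> c \<and> moves (snd (run alg P A B t)) \<le> c)"

text \<open>Since an agent stops when it declares, neither agent has declared before round \<open>t\<close> here.\<close>

definition rendezvous_at :: "algorithm \<Rightarrow> port_graph \<Rightarrow> agent \<Rightarrow> agent \<Rightarrow> nat \<Rightarrow> bool" where
  "rendezvous_at alg P A B t \<longleftrightarrow>
     declares (choice alg P t A (fst (run alg P A B t))) \<and>
     declares (choice alg P t B (snd (run alg P A B t))) \<and>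
     pos (fst (run alg P A B (Suc t))) = pos (snd (run alg P A B (Suc t)))"

text \<open>Time counts from the activation of the later agent, whose activation round is round 1.\<close>

definition rendezvous_in_time :: "algorithm \<Rightarrow> port_graph \<Rightarrow> agent \<Rightarrow> agent \<Rightarrow> nat \<Rightarrow> bool" where
  "rendezvous_in_time alg P A B T \<longleftrightarrow>
     (\<exists>t. rendezvous_at alg P A B t \<and> T = t + 1 - max (wake A) (wake B))"

definition valid_agents :: "port_graph \<Rightarrow> agent \<Rightarrow> agent \<Rightarrow> bool" where
  "valid_agents P A B \<longleftrightarrow>
     lbl A > 0 \<and> lbl B > 0 \<and> lbl A \<noteq> lbl B \<and> start A \<in> nodes P \<and> start B \<in> nodes P"

definition rendezvous_algorithm :: "algorithm \<Rightarrow> port_graph \<Rightarrow> bool" where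
  "rendezvous_algorithm alg P \<longleftrightarrow>
     (\<forall>A B. valid_agents P A B \<longrightarrow> (\<exists>T. rendezvous_in_time alg P A B T))"


section \<open>Universal exploration sequences\<close>

text \<open>
  Node and port of entry after \<open>i\<close> steps of the walk from \<open>v\<close> (the port of entry after \<open>0\<close>
  steps is a dummy). The sequence is indexed from 1; \<open>x 0\<close> is not used.
\<close>

primrec exp_walk :: "(nat \<Rightarrow> nat) \<Rightarrow> port_graph \<Rightarrow> nat \<Rightarrow> nat \<Rightarrow> nat \<times> nat" where
  "exp_walk x P v 0 = (v, 0)"
| "exp_walk x P v (Suc i) =
     (let (u, p) = exp_walk x P v i;
          q = (if i = 0 then 0 else (p + x i) mod deg P u);
          w = nbr P u q
      in (w, port P w u))"

definition universal_exploration :: "(nat \<Rightarrow> nat) \<Rightarrow> (nat \<Rightarrow> nat) \<Rightarrow> bool" where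
  "universal_exploration x R \<longleftrightarrow>
     (\<exists>q :: real poly. \<forall>m. real (R m) = poly q (real m)) \<and>
     (\<forall>m P v. is_port_graph P \<and> card (nodes P) \<le> m \<and> v \<in> nodes P \<longrightarrow>
        nodes P \<subseteq> (\<lambda>i. fst (exp_walk x P v i)) ` {..R m})"


section \<open>Label transformation\<close>

text \<open>Binary representation, most significant bit first.\<close>

fun bits :: "nat \<Rightarrow> bool list" where
  "bits n = (if n = 0 then [] else bits (n div 2) @ [odd n])"

declare bits.simps [simp del]

definition lg :: "nat \<Rightarrow> nat" where
  "lg l = length (bits l)"

definition T1 :: "nat \<Rightarrow> bool list" where
  "T1 L = [False, True] @ concat (map (\<lambda>c. [c, c]) (bits L)) @ [False, True]"

definition T2 :: "nat \<Rightarrow> bool list" where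
  "T2 L = concat (map (\<lambda>b. if b then [True, False] else [False, False]) (T1 L))"


section \<open>Algorithm Fast-bounded-energy-RV-with-detection\<close>

text \<open>Rounds are counted from 1 since the activation of the agent.\<close>

definition obs :: "history \<Rightarrow> nat \<Rightarrow> observation" where
  "obs h i = h ! (i - 1)"

definition first_round :: "(sound \<Rightarrow> bool) \<Rightarrow> nat \<Rightarrow> history \<Rightarrow> nat option" where
  "first_round Q k h =
     (if \<exists>i. k \<le> i \<and> 1 \<le> i \<and> i \<le> length h \<and> Q (heard (obs h i))
      then Some (LEAST i. k \<le> i \<and> 1 \<le> i \<and> i \<le> length h \<and> Q (heard (obs h i)))
      else None)"

definition idle :: action where
  "idle = Action None False False"

definition beep_only :: action where
  "beep_only = Action None True False"

definition declare_if :: "bool \<Rightarrow> action" where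
  "declare_if b = Action None False b"

text \<open>The action in the \<open>j\<close>-th round (\<open>j \<ge> 1\<close>) of Modified-beeping-exploration. Step \<open>k + 1\<close> of
  \<open>EXP(n)\<close> takes place in its round \<open>2 * k + 1\<close>, two rounds after step \<open>k\<close>; \<open>i\<close> is the number of
  the current round since activation.\<close>

definition modified_exploration ::
  "(nat \<Rightarrow> nat) \<Rightarrow> (nat \<Rightarrow> nat) \<Rightarrow> nat \<Rightarrow> nat \<Rightarrow> nat \<Rightarrow> history \<Rightarrow> action"
where
  "modified_exploration x R n j i h =
     (let k = (j - 1) div 2 in
      if odd j \<and> k < R n then
        Action
          (Some (if k = 0 then 0
                 else let (d, p) = the (entered (obs h (i - 2))) in (p + x k) mod d))
          True False
      else idle)"

definition waiting_phase :: "nat \<Rightarrow> nat \<Rightarrow> history \<Rightarrow> action" where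
  "waiting_phase red i h =
     (case first_round (\<lambda>s. s = Loud) red h of
        None \<Rightarrow> idle
      | Some t \<Rightarrow> if i = t + 1 then beep_only else declare_if (i = t + 2))"

definition walking_phase ::
  "(nat \<Rightarrow> nat) \<Rightarrow> (nat \<Rightarrow> nat) \<Rightarrow> nat \<Rightarrow> nat \<Rightarrow> nat \<Rightarrow> history \<Rightarrow> action"
where
  "walking_phase x R n red i h =
     (case first_round (\<lambda>s. s = Loud) red h of
        None \<Rightarrow> modified_exploration x R n (i - red + 1) i h
      | Some t \<Rightarrow> declare_if (i = t + 1))"

definition fast_rv :: "(nat \<Rightarrow> nat) \<Rightarrow> (nat \<Rightarrow> nat) \<Rightarrow> nat \<Rightarrow> algorithm" where
  "fast_rv x R n L d0 h =
     (let i = length h + 1 in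
      case first_round (\<lambda>s. s \<noteq> Silence) 1 h of
        None \<Rightarrow> if i \<le> length (T2 L) \<and> T2 L ! (i - 1) then beep_only else idle
      | Some r \<Rightarrow>
          (let waiting = (r \<ge> 2 \<and> beeps (act (obs h (r - 1))));
               red = (if waiting then r + 1 else r + 2)
           in if i < red then beep_only
              else if heard (obs h r) = Loud then declare_if (i = red)
              else if waiting then waiting_phase red i h
              else walking_phase x R n red i h))"

end

theory Submission
  imports Defs
begin

text \<open>
  Upper bound. Let \<open>t\<close> be the first round, with both agents awake, in which exactly one of them
  beeps according to its \<open>T2\<close>. Up to then nobody hears anything, and since a beep is never followed
  by a beep in \<open>T2\<close>, the listener of round \<open>t\<close> becomes the walker, the beeper becomes the waiter, and
  both call round \<open>t + 2\<close> red. Whatever the delay, \<open>t\<close> comes \<open>O(log \<ell>)\<close> rounds after the later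
  activation: for delay \<open>0\<close> the sequences \<open>T1\<close> are prefix-free, and for a positive delay the
  markers \<open>01\<close> cannot be matched against a shifted copy. From the red round on, the walk needs at
  most \<open>2 R(n) + O(1)\<close> rounds.

  Lower bound. Start both agents in the same round at the two nodes of the two-node graph. As long as
  they beep in the same rounds and move in the same rounds, they hear nothing and never meet. In
  \<open>m\<close> rounds there are only \<open>4 ^ m\<close> such behaviours, so two of the \<open>2 ^ k\<close> labels of length
  \<open>k + 1\<close> share theirs when \<open>2 * m < k\<close>.
\<close>

section \<open>Label sequences\<close>

lemma length_concat_pairs: "length (concat (map (\<lambda>c. [f c, g c]) cs)) = 2 * length cs"
  by (induction cs) auto

lemma nth_concat_pairs:
  assumes "i < length cs"
  shows "concat (map (\<lambda>c. [f c, g c]) cs) ! (2 * i) = f (cs ! i)"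
    and "concat (map (\<lambda>c. [f c, g c]) cs) ! (2 * i + 1) = g (cs ! i)"
proof -
  have "concat (map (\<lambda>c. [f c, g c]) cs) ! (2 * i) = f (cs ! i) \<and>
        concat (map (\<lambda>c. [f c, g c]) cs) ! (2 * i + 1) = g (cs ! i)"
    using assms
  proof (induction cs arbitrary: i)
    case (Cons c cs)
    then show ?case by (cases i) auto
  qed simp
  then show "concat (map (\<lambda>c. [f c, g c]) cs) ! (2 * i) = f (cs ! i)"
    and "concat (map (\<lambda>c. [f c, g c]) cs) ! (2 * i + 1) = g (cs ! i)"
    by auto
qed

section \<open>Binary representation and its length\<close>

lemma bits_0 [simp]: "bits 0 = []"
  by (simp add: bits.simps)

lemma bits_pos: "n > 0 \<Longrightarrow> bits n = bits (n div 2) @ [odd n]"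
  by (subst bits.simps) simp

lemma bits_inject: "bits a = bits b \<Longrightarrow> a = b"
proof (induction a arbitrary: b rule: less_induct)
  case (less a)
  have "a = 0 \<longleftrightarrow> b = 0"
    using less.prems bits_pos[of a] bits_pos[of b] by (cases "a = 0"; cases "b = 0") auto
  then show ?case
  proof (cases "a = 0")
    case False
    then have pos: "a > 0" "b > 0"
      using \<open>a = 0 \<longleftrightarrow> b = 0\<close> by auto
    then have "bits (a div 2) = bits (b div 2)" and par: "odd a = odd b"
      using less.prems bits_pos[of a] bits_pos[of b] by auto
    then have "a div 2 = b div 2"
      using less.IH[of "a div 2" "b div 2"] pos by simp
    then show ?thesis
      using par by (metis div_mult_mod_eq parity_cases)
  qed auto
qed

lemma lg_pos: "n > 0 \<Longrightarrow> lg n > 0"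
  by (simp add: lg_def bits_pos)

lemma lg_double: "n > 0 \<Longrightarrow> lg n = lg (n div 2) + 1"
  by (simp add: lg_def bits_pos)

lemma lg_eqI: "2 ^ k \<le> n \<Longrightarrow> n < 2 ^ Suc k \<Longrightarrow> lg n = k + 1"
proof (induction k arbitrary: n)
  case 0
  then have "n = 1" by simp
  then show ?case using lg_double[of 1] by (simp add: lg_def)
next
  case (Suc k)
  then have "2 ^ k \<le> n div 2" "n div 2 < 2 ^ Suc k"
    by simp_all
  moreover have "n > 0"
    using Suc.prems(1) by (auto intro: Nat.gr0I)
  ultimately show ?case
    using Suc.IH lg_double[of n] by simp
qed

lemma lg_mono: "m \<le> n \<Longrightarrow> lg m \<le> lg n"
proof (induction n arbitrary: m rule: less_induct)
  case (less n)
  show ?case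
  proof (cases "m = 0")
    case False
    then show ?thesis
      using less.IH[of "n div 2" "m div 2"] less.prems lg_double[of m] lg_double[of n]
      by (simp add: div_le_mono)
  qed (simp add: lg_def)
qed

lemma bits_nth_0: "n > 0 \<Longrightarrow> bits n ! 0"
proof (induction n rule: less_induct)
  case (less n)
  show ?case
  proof (cases "n div 2 = 0")
    case True
    then have "n = 1" using less.prems by simp
    then show ?thesis by (simp add: bits_pos)
  next
    case False
    then have "bits (n div 2) ! 0" "bits (n div 2) \<noteq> []"
      using less.IH[of "n div 2"] less.prems lg_pos[of "n div 2"] by (auto simp: lg_def)
    then show ?thesis
      using less.prems by (simp add: bits_pos[of n] nth_append)
  qed
qed

section \<open>Ones of the label sequences and of their shifted copies\<close>

text \<open>An agent whose sequence is exhausted keeps listening, so positions past the end read as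
  \<open>False\<close>. Sequences of different lengths can then be compared under any shift.\<close>

definition padded_nth :: "bool list \<Rightarrow> nat \<Rightarrow> bool" where
  "padded_nth bs i \<longleftrightarrow> i < length bs \<and> bs ! i"

lemma length_T1: "length (T1 L) = 2 * lg L + 4"
  by (simp add: T1_def lg_def length_concat_pairs)

lemma T2_eq: "T2 L = concat (map (\<lambda>b. [b, False]) (T1 L))"
  unfolding T2_def by (rule arg_cong[where f = concat]) auto

lemma padded_T2: "padded_nth (T2 L) i \<longleftrightarrow> even i \<and> padded_nth (T1 L) (i div 2)"
proof (cases "even i")
  case True
  then obtain j where "i = 2 * j" by blast
  then show ?thesis
    using nth_concat_pairs(1)[of j "T1 L" "\<lambda>b. b" "\<lambda>_. False"]
    by (auto simp: padded_nth_def T2_eq length_concat_pairs)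
next
  case False
  then obtain j where "i = 2 * j + 1" using oddE by blast
  then show ?thesis
    using nth_concat_pairs(2)[of j "T1 L" "\<lambda>b. b" "\<lambda>_. False"]
    by (auto simp: padded_nth_def T2_eq length_concat_pairs)
qed

lemma padded_T1_marker:
  "\<not> padded_nth (T1 L) 0" "padded_nth (T1 L) (Suc 0)"
  "\<not> padded_nth (T1 L) (2 * lg L + 2)" "padded_nth (T1 L) (2 * lg L + 3)"
  by (auto simp: padded_nth_def T1_def nth_append length_concat_pairs lg_def)

lemma padded_T1_data:
  assumes "i < lg L"
  shows "padded_nth (T1 L) (2 * i + 2) = bits L ! i"
    and "padded_nth (T1 L) (2 * i + 3) = bits L ! i"
  using assms nth_concat_pairs[of i "bits L" "\<lambda>c. c" "\<lambda>c. c"]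
  by (auto simp: padded_nth_def T1_def nth_append length_concat_pairs lg_def numeral_eq_Suc)

lemma padded_T1_outside: "j \<ge> 2 * lg L + 4 \<Longrightarrow> \<not> padded_nth (T1 L) j"
  by (simp add: padded_nth_def length_T1)

text \<open>For \<open>i = lg L\<close> the even position holds the zero of the end marker, and
  larger \<open>i\<close> lead past the end. A one there is therefore the first half of a doubled
  bit.\<close>

lemma padded_T1_pair:
  "padded_nth (T1 L) (2 * i + 2) \<Longrightarrow> i < lg L \<and> padded_nth (T1 L) (2 * i + 3)"
  using padded_T1_data[of i L] padded_T1_marker(3)[of L] padded_T1_outside[of L "2 * i + 2"]
  by (cases i "lg L" rule: linorder_cases) auto

text \<open>With different lengths, the end marker 01 of the shorter sequence faces a doubled bit of
  the longer one, whose halves agree. With equal lengths, injectivity of \<open>bits\<close> yields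
  a differing data bit.\<close>

lemma T1_prefix_free:
  assumes "a \<noteq> b"
  shows "\<exists>j < 2 * min (lg a) (lg b) + 4. padded_nth (T1 b) j \<noteq> padded_nth (T1 a) j"
proof (rule ccontr)
  assume "\<not> ?thesis"
  then have eq: "padded_nth (T1 b) j = padded_nth (T1 a) j" if "j < 2 * min (lg a) (lg b) + 4" for j
    using that by auto
  consider "lg a < lg b" | "lg b < lg a" | "lg a = lg b" by linarith
  then show False
  proof cases
    case 1
    then show ?thesis
      using eq[of "2 * lg a + 2"] eq[of "2 * lg a + 3"] padded_T1_marker[of a]
        padded_T1_data[of "lg a" b] by simp
  next
    case 2
    then show ?thesis
      using eq[of "2 * lg b + 2"] eq[of "2 * lg b + 3"] padded_T1_marker[of b]
        padded_T1_data[of "lg b" a] by simp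
  next
    case 3
    have "bits a = bits b"
    proof (rule nth_equalityI)
      fix i assume "i < length (bits a)"
      then show "bits a ! i = bits b ! i"
        using eq[of "2 * i + 2"] 3 padded_T1_data(1)[of i a] padded_T1_data(1)[of i b]
        by (simp add: lg_def)
    qed (use 3 in \<open>simp add: lg_def\<close>)
    then show False using assms bits_inject by blast
  qed
qed

text \<open>The start marker 01 of \<open>b\<close> faces an aligned pair of \<open>a\<close> with
  unequal halves, which after a positive shift can only be the end marker. Then the leading one of
  \<open>b\<close> faces a position past the end of \<open>a\<close>.\<close>

lemma T1_even_shift_differs:
  assumes "a > 0" "b > 0" "d > 0"
  shows "\<exists>j < 2 * min (lg a) (lg b) + 4. padded_nth (T1 b) j \<noteq> padded_nth (T1 a) (j + 2 * d)"
proof (rule ccontr)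
  assume "\<not> ?thesis"
  then have eq: "padded_nth (T1 b) j = padded_nth (T1 a) (j + 2 * d)"
    if "j < 2 * min (lg a) (lg b) + 4" for j
    using that by auto
  have "lg a > 0" "lg b > 0" using assms lg_pos by auto
  then have m: "min (lg a) (lg b) \<ge> 1" by simp
  obtain i where i: "d = Suc i" using assms(3) gr0_conv_Suc by blast
  have "\<not> padded_nth (T1 a) (2 * i + 2)" "padded_nth (T1 a) (2 * i + 3)"
    using eq[of 0] eq[of 1] m padded_T1_marker[of b] i by (auto simp: numeral_eq_Suc)
  then have "i = lg a"
    using padded_T1_data[of i a] padded_T1_outside[of a "2 * i + 3"]
    by (cases i "lg a" rule: linorder_cases) auto
  moreover have "padded_nth (T1 b) 2"
    using padded_T1_data(1)[of 0 b] bits_nth_0[of b] assms(2) \<open>lg b > 0\<close>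
    by (simp add: numeral_2_eq_2)
  ultimately show False
    using eq[of 2] m i padded_T1_outside[of a "2 + 2 * d"] by simp
qed

text \<open>
  With an odd shift the pairs of equal bits of the two sequences overlap, so that agreement forces
  ones throughout, up to the end marker of one of them.
\<close>

lemma T1_odd_shift_differs:
  shows "\<exists>j < 2 * min (lg a) (lg b) + 4. padded_nth (T1 b) j \<noteq> padded_nth (T1 a) (j + 2 * d + 1)"
proof (rule ccontr)
  assume neg: "\<not> ?thesis"
  obtain M where M: "M = min (lg a) (lg b)" by blast
  then have eq: "padded_nth (T1 b) j = padded_nth (T1 a) (j + 2 * d + 1)" if "j < 2 * M + 4" for j
    using that neg by auto
  \<comment> \<open>A one of \<open>b\<close> at \<open>2 * i + 1\<close> faces the first half of
    data pair \<open>i + d\<close> of \<open>a\<close>, so that pair is 11. Its second half faces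
    the first half of data pair \<open>i\<close> of \<open>b\<close>, which is then 11 as
    well.\<close>
  have step: "i + d < lg a \<and> i < lg b \<and> padded_nth (T1 b) (2 * i + 3)"
    if "i \<le> M" "padded_nth (T1 b) (2 * i + 1)" for i
  proof -
    have "2 * i + 1 + 2 * d + 1 = 2 * (i + d) + 2" by simp
    then have "padded_nth (T1 a) (2 * (i + d) + 2)"
      using that eq[of "2 * i + 1"] by simp
    then have a: "i + d < lg a" "padded_nth (T1 a) (2 * (i + d) + 3)"
      using padded_T1_pair by blast+
    have "2 * i + 2 < 2 * M + 4" using that(1) by linarith
    then have "padded_nth (T1 b) (2 * i + 2) = padded_nth (T1 a) (2 * i + 2 + 2 * d + 1)"
      by (rule eq)
    moreover have "2 * i + 2 + 2 * d + 1 = 2 * (i + d) + 3" by simp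
    ultimately have "padded_nth (T1 b) (2 * i + 2)"
      using a(2) by metis
    then show ?thesis
      using a(1) padded_T1_pair by blast
  qed
  have ones: "i \<le> M \<Longrightarrow> padded_nth (T1 b) (2 * i + 1)" for i
  proof (induction i)
    case 0
    then show ?case using padded_T1_marker(2)[of b] by simp
  next
    case (Suc i)
    then show ?case using step[of i] by (simp add: numeral_eq_Suc)
  qed
  \<comment> \<open>At \<open>i = M\<close> the propagation puts \<open>M\<close> strictly below
    both lengths, although it is their minimum.\<close>
  show False
    using step[OF order_refl ones[OF order_refl]] M by linarith
qed

text \<open>Here \<open>b\<close> belongs to the agent activated \<open>e\<close> rounds later. Ones
  of \<open>T2\<close> occupy even positions only, so an odd shift fails at the first one of
  \<open>b\<close>, and an even shift \<open>2 * d\<close> is a shift of \<open>T1\<close> by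
  \<open>d\<close>, treated by the parity of \<open>d\<close>. The bound involves only the shorter
  label, whatever the delay.\<close>

lemma T2_shift_differs:
  assumes "a > 0" "b > 0" "a \<noteq> b"
  shows "\<exists>i < 4 * min (lg a) (lg b) + 8. padded_nth (T2 b) i \<noteq> padded_nth (T2 a) (i + e)"
proof (cases "even e")
  case False
  then show ?thesis
    using padded_T1_marker(2)[of b] by (intro exI[of _ 2]) (simp add: padded_T2)
next
  case True
  then obtain d where e: "e = 2 * d" by blast
  consider "d = 0" | k where "d = 2 * k" "k > 0" | k where "d = 2 * k + 1"
  proof (cases "even d")
    case True
    then obtain k where "d = 2 * k" by blast
    then show ?thesis using that(1,2) by (cases "k = 0") auto
  qed (use that(3) in \<open>auto elim!: oddE\<close>)
  then have "\<exists>j < 2 * min (lg a) (lg b) + 4. padded_nth (T1 b) j \<noteq> padded_nth (T1 a) (j + d)"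
  proof cases
    case 1
    then show ?thesis using T1_prefix_free[OF assms(3)] by simp
  next
    case 2
    then show ?thesis using T1_even_shift_differs[OF assms(1,2)] by simp
  next
    case 3
    then show ?thesis using T1_odd_shift_differs[of a b] by (simp add: add.assoc)
  qed
  then obtain j where j: "j < 2 * min (lg a) (lg b) + 4"
    "padded_nth (T1 b) j \<noteq> padded_nth (T1 a) (j + d)"
    by blast
  have "(2 * j + e) div 2 = j + d"
    using e by simp
  then have "padded_nth (T2 b) (2 * j) \<noteq> padded_nth (T2 a) (2 * j + e)"
    using j(2) e by (simp add: padded_T2)
  moreover have "2 * j < 4 * min (lg a) (lg b) + 8"
    using j(1) by linarith
  ultimately show ?thesis by blast
qed

text \<open>This makes the roles opposite: the beeper of the first differing round listens in the
  next one, and the listener was silent in the previous one if both were awake then.\<close>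

lemma T2_not_consecutive: "padded_nth (T2 L) i \<Longrightarrow> \<not> padded_nth (T2 L) (Suc i)"
  by (simp add: padded_T2)

text \<open>Hence the beeper of the first differing round was already awake in the round
  before.\<close>

lemma T2_starts_silent: "\<not> padded_nth (T2 L) 0"
  using padded_T1_marker(1) by (simp add: padded_T2)

section \<open>First sounds and executions\<close>

lemma first_round_Some_iff:
  "first_round Q k h = Some r \<longleftrightarrow>
     k \<le> r \<and> 1 \<le> r \<and> r \<le> length h \<and> Q (heard (obs h r)) \<and>
     (\<forall>i. k \<le> i \<and> 1 \<le> i \<and> i < r \<longrightarrow> \<not> Q (heard (obs h i)))"
  (is "?lhs \<longleftrightarrow> ?rhs")
proof
  let ?P = "\<lambda>i. k \<le> i \<and> 1 \<le> i \<and> i \<le> length h \<and> Q (heard (obs h i))"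
  assume ?lhs
  then have ex: "\<exists>i. ?P i" and r: "r = (LEAST i. ?P i)"
    by (auto simp: first_round_def split: if_splits)
  have "?P r"
    using LeastI_ex[OF ex] r by simp
  moreover have "\<not> ?P i" if "i < r" for i
    using not_less_Least that r by blast
  ultimately show ?rhs
    by (meson less_imp_le order_trans)
next
  assume ?rhs
  then have "(LEAST i. k \<le> i \<and> 1 \<le> i \<and> i \<le> length h \<and> Q (heard (obs h i))) = r"
    by (intro Least_equality) (auto simp: not_less[symmetric])
  then show ?lhs
    using \<open>?rhs\<close> by (auto simp: first_round_def)
qed

lemma first_round_None_iff:
  "first_round Q k h = None \<longleftrightarrow>
     (\<forall>i. k \<le> i \<and> 1 \<le> i \<and> i \<le> length h \<longrightarrow> \<not> Q (heard (obs h i)))"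
  by (auto simp: first_round_def)

lemma obs_append [simp]: "1 \<le> i \<Longrightarrow> i \<le> length h \<Longrightarrow> obs (h @ h') i = obs h i"
  by (auto simp: obs_def nth_append)

lemma obs_snoc [simp]: "obs (h @ [e]) (Suc (length h)) = e"
  by (simp add: obs_def)

lemma first_round_append_Some: "first_round Q k h = Some r \<Longrightarrow> first_round Q k (h @ h') = Some r"
  by (auto simp: first_round_Some_iff)

lemma first_round_snoc:
  "first_round Q k (h @ [e]) =
     (case first_round Q k h of
        Some r \<Rightarrow> Some r
      | None \<Rightarrow> if k \<le> length h + 1 \<and> Q (heard e) then Some (length h + 1) else None)"
proof (cases "first_round Q k h")
  case None
  then have silent: "\<forall>i. k \<le> i \<and> 1 \<le> i \<and> i \<le> length h \<longrightarrow> \<not> Q (heard (obs h i))"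
    by (simp only: first_round_None_iff)
  show ?thesis
  proof (cases "k \<le> length h + 1 \<and> Q (heard e)")
    case True
    then have "first_round Q k (h @ [e]) = Some (length h + 1)"
      using silent by (auto simp: first_round_Some_iff)
    then show ?thesis using None True by simp
  next
    case False
    then have "first_round Q k (h @ [e]) = None"
      using silent by (auto simp: first_round_None_iff le_Suc_eq)
    then show ?thesis using None False by simp
  qed
next
  case (Some r)
  then show ?thesis
    using first_round_append_Some[of Q k h r "[e]"] by simp
qed

lemma traverses_stay [simp]: "\<not> traverses P v (Action None b d)"
  by (simp add: traverses_def)

lemma target_stay [simp]: "target P v (Action None b d) = v"
  by (simp add: target_def)

lemmas stay_defs = idle_def beep_only_def declare_if_def

text \<open>Symmetry between the agents, which later allows the first one to be taken as the
  listener.\<close>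

lemma run_swap: "run alg P B A t = prod.swap (run alg P A B t)"
  by (induction t) (auto split: prod.splits simp: Let_def)

lemma rendezvous_at_swap: "rendezvous_at alg P A B t \<Longrightarrow> rendezvous_at alg P B A t"
  unfolding rendezvous_at_def by (simp add: run_swap[of alg P B A] del: run.simps)

lemma moves_step: "moves (step alg P t A s B s') \<in> {moves s..moves s + 1}"
  by (simp add: step_def moves_def Let_def)

lemma moves_run_mono:
  assumes "t \<le> t'"
  shows "moves (fst (run alg P A B t)) \<le> moves (fst (run alg P A B t'))"
  using assms
proof (induction rule: dec_induct)
  case (step t)
  then show ?case
    using moves_step[of alg P t A "fst (run alg P A B t)" B "snd (run alg P A B t)"]
    by (auto simp: split_beta Let_def)
qed simp

lemma run_stopped:
  assumes "stopped (fst (run alg P A B t))" "stopped (snd (run alg P A B t))" "t \<le> t'"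
  shows "run alg P A B t' = run alg P A B t"
  using assms(3)
proof (induction rule: dec_induct)
  case (step t')
  then show ?case
    using assms(1,2) by (simp add: split_beta Let_def step_def active_def prod_eq_iff)
qed simp

lemma step_declares: "declares (choice alg P t A s) \<Longrightarrow> stopped (step alg P t A s B s')"
  by (auto simp: choice_def step_def Let_def stopped_def split: if_splits)

text \<open>The \<open>+ 1\<close> covers a possible traversal in the declaring round itself; after
  that round both agents are frozen.\<close>

lemma moves_fst_le:
  assumes rv: "rendezvous_at alg P A B t" and m: "moves (fst (run alg P A B t)) \<le> m"
  shows "moves (fst (run alg P A B t')) \<le> m + 1"
proof -
  let ?r = "run alg P A B"
  have suc: "moves (fst (?r (Suc t))) \<le> m + 1"
    using m moves_step[of alg P t A "fst (?r t)" B "snd (?r t)"] by (auto simp: split_beta Let_def)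
  have "stopped (fst (?r (Suc t)))" "stopped (snd (?r (Suc t)))"
    using rv by (auto simp: rendezvous_at_def split_beta Let_def step_declares)
  then have "Suc t \<le> t' \<Longrightarrow> ?r t' = ?r (Suc t)"
    by (rule run_stopped)
  then show ?thesis
    using suc moves_run_mono[of t' "Suc t" alg P A B] by (cases "Suc t \<le> t'") auto
qed

lemma moves_bounded_rendezvous:
  assumes "rendezvous_at alg P A B t"
    and "moves (fst (run alg P A B t)) \<le> m" "moves (snd (run alg P A B t)) \<le> m"
  shows "moves_bounded alg P A B (m + 1)"
  using moves_fst_le[OF assms(1,2)] moves_fst_le[OF rendezvous_at_swap[OF assms(1)], of m] assms(3)
  by (simp add: moves_bounded_def run_swap[of alg P B A])

lemma moves_bounded_swap: "moves_bounded alg P A B c \<Longrightarrow> moves_bounded alg P B A c"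
  by (simp add: moves_bounded_def run_swap[of alg P B A])

section \<open>Executions before the first sound\<close>

text \<open>The index counts from 0, so this is the action of round \<open>i + 1\<close> since
  activation.\<close>

definition sb_action :: "nat \<Rightarrow> nat \<Rightarrow> action" where
  "sb_action L i = (if padded_nth (T2 L) i then beep_only else idle)"

definition sb_history :: "nat \<Rightarrow> nat \<Rightarrow> history" where
  "sb_history L m = map (\<lambda>i. Obs (sb_action L i) None Silence) [0..<m]"

lemma length_sb_history [simp]: "length (sb_history L m) = m"
  by (simp add: sb_history_def)

lemma sb_history_Suc: "sb_history L (Suc m) = sb_history L m @ [Obs (sb_action L m) None Silence]"
  by (simp add: sb_history_def)

lemma obs_sb_history:
  "1 \<le> i \<Longrightarrow> i \<le> m \<Longrightarrow> obs (sb_history L m) i = Obs (sb_action L (i - 1)) None Silence"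
  by (auto simp: sb_history_def obs_def)

lemma first_round_sb_history: "first_round (\<lambda>s. s \<noteq> Silence) k (sb_history L m) = None"
  by (auto simp: first_round_None_iff obs_sb_history)

lemma fast_rv_sb_history: "fast_rv x R n L d (sb_history L m) = sb_action L m"
  by (simp add: fast_rv_def first_round_sb_history sb_action_def padded_nth_def)

lemma sb_history_quiet: "e \<in> set (sb_history L m) \<Longrightarrow> \<not> declares (act e) \<and> entered e = None"
  by (auto simp: sb_history_def sb_action_def stay_defs split: if_splits)

lemma stopped_sb_history: "\<not> stopped \<lparr>pos = v, hist = sb_history L m\<rparr>"
  using sb_history_quiet by (auto simp: stopped_def)

lemma sb_action_stay: "sb_action L i = Action None (padded_nth (T2 L) i) False"
  by (simp add: sb_action_def stay_defs)

text \<open>Two awake agents beep together or listen together, and a lone awake agent hears no one,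
  so no sound is recorded. Truncated subtraction gives a sleeping agent the empty history.\<close>

lemma step_silent:
  assumes "wake A \<le> t \<Longrightarrow> wake B \<le> t \<Longrightarrow>
    padded_nth (T2 (lbl A)) (t - wake A) = padded_nth (T2 (lbl B)) (t - wake B)"
  shows "step (fast_rv x R n) P t A \<lparr>pos = start A, hist = sb_history (lbl A) (t - wake A)\<rparr>
       B \<lparr>pos = start B, hist = sb_history (lbl B) (t - wake B)\<rparr>
     = \<lparr>pos = start A, hist = sb_history (lbl A) (Suc t - wake A)\<rparr>"
  using assms
  by (cases "wake A \<le> t"; cases "wake B \<le> t")
    (simp_all add: step_def choice_def active_def stopped_sb_history fast_rv_sb_history sb_action_stay
      Let_def Suc_diff_le sb_history_Suc)

lemma run_silent:
  assumes "\<And>u. wake A \<le> u \<Longrightarrow> wake B \<le> u \<Longrightarrow> u < t \<Longrightarrow>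
    padded_nth (T2 (lbl A)) (u - wake A) = padded_nth (T2 (lbl B)) (u - wake B)"
  shows "run (fast_rv x R n) P A B t =
    (\<lparr>pos = start A, hist = sb_history (lbl A) (t - wake A)\<rparr>,
     \<lparr>pos = start B, hist = sb_history (lbl B) (t - wake B)\<rparr>)"
  using assms
proof (induction t)
  case 0
  then show ?case by (simp add: sb_history_def)
next
  case (Suc t)
  have "run (fast_rv x R n) P A B t =
    (\<lparr>pos = start A, hist = sb_history (lbl A) (t - wake A)\<rparr>,
     \<lparr>pos = start B, hist = sb_history (lbl B) (t - wake B)\<rparr>)"
    using Suc by simp
  then show ?case
    using Suc.prems[of t] step_silent[of A t B x R n P] step_silent[of B t A x R n P]
    by (simp add: eq_commute)
qed

section \<open>Breaking symmetry\<close>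

text \<open>The red round is \<open>r + 2\<close> because the walker answers with a beep in round
  \<open>r + 1\<close>. The bound on \<open>length h\<close> says that the upcoming round is the red
  one or later.\<close>

definition walker :: "nat \<Rightarrow> history \<Rightarrow> bool" where
  "walker r h \<longleftrightarrow>
     first_round (\<lambda>s. s \<noteq> Silence) 1 h = Some r \<and> \<not> (2 \<le> r \<and> beeps (act (obs h (r - 1)))) \<and>
     heard (obs h r) = Soft \<and> r + 1 \<le> length h \<and> first_round (\<lambda>s. s = Loud) (r + 2) h = None"

text \<open>Here \<open>r\<close> is the round in which the walker's answer arrives, so the red
  round is already \<open>r + 1\<close>.\<close>

definition waiter :: "nat \<Rightarrow> history \<Rightarrow> bool" where
  "waiter r h \<longleftrightarrow>
     first_round (\<lambda>s. s \<noteq> Silence) 1 h = Some r \<and> 2 \<le> r \<and> beeps (act (obs h (r - 1))) \<and>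
     heard (obs h r) = Soft \<and> r \<le> length h \<and> first_round (\<lambda>s. s = Loud) (r + 1) h = None"

text \<open>With \<open>red = r + 2\<close> and current round \<open>length h + 1\<close>, the
  exploration index \<open>i - red + 1\<close> is \<open>length h - r\<close>.\<close>

lemma fast_rv_walker:
  "walker r h \<Longrightarrow> fast_rv x R n L d h = modified_exploration x R n (length h - r) (length h + 1) h"
  by (auto simp: walker_def fast_rv_def walking_phase_def Suc_diff_Suc)

lemma fast_rv_waiter: "waiter r h \<Longrightarrow> fast_rv x R n L d h = idle"
  by (auto simp: waiter_def fast_rv_def waiting_phase_def)

lemma walker_snoc:
  assumes "walker r h" "heard e \<noteq> Loud"
  shows "walker r (h @ [e])"
proof -
  have r: "1 \<le> r" "r \<le> length h"
    using assms by (auto simp: walker_def first_round_Some_iff)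
  then show ?thesis
    using assms by (auto simp: walker_def first_round_snoc)
qed

lemma waiter_snoc:
  assumes "waiter r h" "heard e \<noteq> Loud"
  shows "waiter r (h @ [e])"
proof -
  have r: "1 \<le> r" "r \<le> length h"
    using assms by (auto simp: waiter_def first_round_Some_iff)
  then show ?thesis
    using assms by (auto simp: waiter_def first_round_snoc)
qed

lemma fast_rv_walker_loud:
  assumes "walker r h" "heard e = Loud"
  shows "fast_rv x R n L d (h @ [e]) = Action None False True"
proof -
  have r: "1 \<le> r" "r \<le> length h"
    using assms by (auto simp: walker_def first_round_Some_iff)
  then show ?thesis
    using assms
    by (cases "2 \<le> r")
      (auto simp: walker_def fast_rv_def walking_phase_def first_round_snoc stay_defs Let_def)
qed

lemma fast_rv_waiter_loud:
  assumes "waiter r h" "heard e = Loud"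
  shows "fast_rv x R n L d (h @ [e]) = Action None True False"
    and "fast_rv x R n L d (h @ [e, e']) = Action None False True"
proof -
  have r: "1 \<le> r" "r \<le> length h"
    using assms by (auto simp: waiter_def first_round_Some_iff)
  then show "fast_rv x R n L d (h @ [e]) = Action None True False"
    using assms
    by (auto simp: waiter_def fast_rv_def waiting_phase_def first_round_snoc stay_defs)
  have "first_round (\<lambda>s. s \<noteq> Silence) 1 (h @ [e, e']) = Some r"
    using assms first_round_append_Some unfolding waiter_def by blast
  moreover have "first_round (\<lambda>s. s = Loud) (r + 1) (h @ [e]) = Some (length h + 1)"
    using assms r by (auto simp: waiter_def first_round_snoc)
  then have "first_round (\<lambda>s. s = Loud) (r + 1) (h @ [e, e']) = Some (length h + 1)"
    using first_round_append_Some[of _ _ "h @ [e]" _ "[e']"] by simp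
  ultimately show "fast_rv x R n L d (h @ [e, e']) = Action None False True"
    using assms r by (auto simp: waiter_def fast_rv_def waiting_phase_def stay_defs)
qed

text \<open>
  The listener of the first round in which the agents differ becomes the walker and the beeper of
  that round the waiter; both call the same round red.
\<close>

lemma first_round_sb_listener:
  assumes "s \<noteq> Silence" "k \<le> Suc m"
  shows "first_round (\<lambda>s. s \<noteq> Silence) k (sb_history L m @ Obs a info s # h) = Some (Suc m)"
  using assms
    first_round_append_Some[of "\<lambda>s. s \<noteq> Silence" k "sb_history L m @ [Obs a info s]" "Suc m" h]
  by (simp add: first_round_snoc first_round_sb_history)

lemma obs_sb_history_append:
  "obs (sb_history L m @ e # h) (Suc m) = e"
  "1 \<le> i \<Longrightarrow> i \<le> m \<Longrightarrow> obs (sb_history L m @ h) i = Obs (sb_action L (i - 1)) None Silence"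
  by (simp add: obs_def nth_append) (simp add: obs_sb_history)

text \<open>The second premise excludes a beep in the round before the sound, so the agent does not
  take the waiting role; for \<open>m = 0\<close> no such round exists. The sound comes in its round
  \<open>m + 1\<close>, hence its red round is \<open>m + 3\<close>.\<close>

lemma fast_rv_listener:
  assumes "s \<noteq> Silence" "\<And>i. m = Suc i \<Longrightarrow> \<not> padded_nth (T2 L) i"
  shows "fast_rv x R n L d (sb_history L m @ [Obs idle None s]) = Action None True False"
    and "s = Loud \<Longrightarrow>
      fast_rv x R n L d (sb_history L m @ [Obs idle None s, e]) = Action None False True"
    and "s = Soft \<Longrightarrow> heard e = Silence \<Longrightarrow>
      walker (m + 1) (sb_history L m @ [Obs idle None s, e])"
proof -
  have nb: "\<not> (2 \<le> m + 1 \<and> beeps (act (obs (sb_history L m @ h) (m + 1 - 1))))" for h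
    using assms(2)[of "m - 1"] by (auto simp: obs_sb_history sb_action_stay)
  show "fast_rv x R n L d (sb_history L m @ [Obs idle None s]) = Action None True False"
    using nb[of "[Obs idle None s]"] assms(1)
    by (cases "m = 0") (auto simp: fast_rv_def first_round_sb_listener stay_defs Let_def)
  show "fast_rv x R n L d (sb_history L m @ [Obs idle None s, e]) = Action None False True"
    if "s = Loud"
    using that nb[of "[Obs idle None s, e]"]
    by (cases "m = 0")
      (auto simp: fast_rv_def first_round_sb_listener obs_sb_history_append stay_defs Let_def)
  show "walker (m + 1) (sb_history L m @ [Obs idle None s, e])" if "s = Soft" "heard e = Silence"
    using that nb[of "[Obs idle None s, e]"]
    by (auto simp: walker_def first_round_sb_listener obs_sb_history_append first_round_None_iff
        numeral_eq_Suc)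
qed

text \<open>The agent beeps in its round \<open>m + 1\<close> and hears the answer in round
  \<open>m + 2\<close>. Its red round is \<open>m + 3\<close>, again two rounds after the first
  difference.\<close>

lemma fast_rv_beeper:
  assumes "s \<noteq> Silence" "padded_nth (T2 L) m"
  shows "s = Loud \<Longrightarrow>
      fast_rv x R n L d (sb_history L (Suc m) @ [Obs a None s]) = Action None False True"
    and "s = Soft \<Longrightarrow> waiter (m + 2) (sb_history L (Suc m) @ [Obs a None s])"
proof -
  have nb: "beeps (act (obs (sb_history L (Suc m) @ h) (Suc m)))" for h
    using assms(2) by (auto simp: obs_sb_history sb_action_stay)
  show "fast_rv x R n L d (sb_history L (Suc m) @ [Obs a None s]) = Action None False True"
    if "s = Loud"
    using that nb[of "[Obs a None s]"]
    by (auto simp: fast_rv_def first_round_sb_listener obs_sb_history_append stay_defs)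
  show "waiter (m + 2) (sb_history L (Suc m) @ [Obs a None s])" if "s = Soft"
    using that nb[of "[Obs a None s]"]
    by (auto simp: waiter_def first_round_sb_listener obs_sb_history_append first_round_None_iff)
qed

section \<open>Exploration\<close>

lemma nbr_arc:
  assumes "is_port_graph P" "v \<in> nodes P" "p < deg P v"
  shows "(v, nbr P v p) \<in> parcs (graph_of P)" "port P v (nbr P v p) = p" "nbr P v p \<in> nodes P"
proof -
  have bij: "bij_betw (port P v) {w. (v, w) \<in> parcs (graph_of P)} {..<deg P v}"
    using assms by (auto simp: is_port_graph_def)
  have "p \<in> port P v ` {w. (v, w) \<in> parcs (graph_of P)}"
    using bij_betw_imp_surj_on[OF bij] assms(3) by simp
  then obtain w where w: "(v, w) \<in> parcs (graph_of P)" "port P v w = p"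
    by blast
  have uniq: "w' = w" if "(v, w') \<in> parcs (graph_of P) \<and> port P v w' = p" for w'
    using inj_onD[OF bij_betw_imp_inj_on[OF bij], of w' w] that w by simp
  have "nbr P v p = w"
    unfolding nbr_def by (rule the_equality) (use w uniq in blast)+
  moreover have "w \<in> nodes P"
    using w(1) assms(1) pair_wf_digraph.arc_snd_in_verts[of "graph_of P" "(v, w)"]
    by (simp add: is_port_graph_def pair_graph_def pair_digraph_def pair_fin_digraph_def)
  ultimately show "(v, nbr P v p) \<in> parcs (graph_of P)" "port P v (nbr P v p) = p"
    "nbr P v p \<in> nodes P"
    using w by auto
qed

text \<open>Connectivity gives a path to \<open>v\<close> from a second node, and its last arc is
  incident to \<open>v\<close>. Positivity makes reduction modulo the degree yield an existing
  port.\<close>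

lemma deg_pos:
  assumes "is_port_graph P" "v \<in> nodes P"
  shows "deg P v > 0"
proof -
  let ?G = "graph_of P"
  have "card (nodes P) \<ge> 2" and conn: "connected (with_proj ?G)" and graph: "pair_graph ?G"
    and bij: "bij_betw (port P v) {w. (v, w) \<in> parcs ?G} {..<deg P v}"
    using assms by (auto simp: is_port_graph_def)
  have "nodes P \<noteq> {v}"
    using \<open>card (nodes P) \<ge> 2\<close> by auto
  then obtain w where w: "w \<in> nodes P" "w \<noteq> v"
    using assms(2) by blast
  have "w \<rightarrow>\<^sup>*\<^bsub>with_proj (mk_symmetric (with_proj ?G))\<^esub> v"
    using conn w(1) assms(2) by (auto simp: connected_def strongly_connected_def)
  then have "(w, v) \<in> rtrancl_on (pverts ?G) (parcs (mk_symmetric (with_proj ?G)))"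
    by (simp add: reachable_def)
  then obtain u where "(u, v) \<in> parcs (mk_symmetric (with_proj ?G))"
    using w(2) by (cases rule: rtrancl_on.cases) auto
  then have "(u, v) \<in> parcs ?G \<or> (v, u) \<in> parcs ?G"
    by (auto simp: parcs_mk_symmetric)
  moreover have sym: "pair_sym_digraph ?G"
    using graph by (simp add: pair_graph_def pair_pseudo_graph_def)
  ultimately have "(v, u) \<in> parcs ?G"
    using pair_sym_digraph.arcs_symmetric[OF sym, of u v] by auto
  then have "port P v u \<in> {..<deg P v}"
    using bij_betw_apply[OF bij] by simp
  then show ?thesis by simp
qed

lemma exp_walk_in_nodes:
  assumes "is_port_graph P" "v \<in> nodes P"
  shows "fst (exp_walk x P v k) \<in> nodes P"
proof (induction k)
  case (Suc k)
  then show ?case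
    using nbr_arc(3)[OF assms(1) Suc] deg_pos[OF assms(1) Suc]
    by (cases k) (simp_all add: split_beta Let_def)
qed (use assms in simp)

text \<open>A listening round without a move separates consecutive steps, so the entry data needed
  for the next port are two rounds old. For \<open>k = 0\<close> there are none and port 0 is
  taken.\<close>

lemma modified_exploration_move:
  assumes "is_port_graph P" "v \<in> nodes P" "k < R n"
    and walk: "exp_walk x P v k = (u, p)"
    and "k > 0 \<Longrightarrow> entered (obs h (i - 2)) = Some (deg P u, p)"
  obtains q where "q < deg P u"
    and "modified_exploration x R n (2 * k + 1) i h = Action (Some q) True False"
    and "exp_walk x P v (Suc k) = (nbr P u q, port P (nbr P u q) u)"
proof
  let ?q = "if k = 0 then 0 else (p + x k) mod deg P u"
  have "u \<in> nodes P"
    using exp_walk_in_nodes[OF assms(1,2), of x k] walk by simp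
  then show "?q < deg P u"
    using deg_pos[OF assms(1)] by simp
  show "modified_exploration x R n (2 * k + 1) i h = Action (Some ?q) True False"
    using assms(3,5) by (auto simp: modified_exploration_def)
  show "exp_walk x P v (Suc k) = (nbr P u ?q, port P (nbr P u ?q) u)"
    using walk by (simp add: Let_def)
qed

text \<open>Used for symbolic execution: once the two actions are explicit, the conditionals
  collapse.\<close>

lemma run_active_step:
  assumes "run alg P A B t = (\<lparr>pos = u, hist = h\<rparr>, \<lparr>pos = w, hist = h'\<rparr>)"
    and "wake A \<le> t" "wake B \<le> t"
    and "\<not> stopped \<lparr>pos = u, hist = h\<rparr>" "\<not> stopped \<lparr>pos = w, hist = h'\<rparr>"
    and "alg (lbl A) (deg P (start A)) h = a" "alg (lbl B) (deg P (start B)) h' = b"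
  shows "run alg P A B (Suc t) =
    (\<lparr>pos = target P u a,
      hist = h @ [Obs a (if traverses P u a then Some (deg P (target P u a), port P (target P u a) u) else None)
        (if beeps a \<or> \<not> beeps b then Silence else if target P u a = target P w b then Loud else Soft)]\<rparr>,
     \<lparr>pos = target P w b,
      hist = h' @ [Obs b (if traverses P w b then Some (deg P (target P w b), port P (target P w b) w) else None)
        (if beeps b \<or> \<not> beeps a then Silence else if target P w b = target P u a then Loud else Soft)]\<rparr>)"
  using assms by (simp add: step_def choice_def active_def Let_def)

section \<open>The walk towards the waiting agent\<close>

text \<open>The situation just before exploration round \<open>2 * k + 1\<close>, with the waiter at
  \<open>w\<close>. The upcoming round has number \<open>r + 2 + 2 * k\<close> for the walker, and
  its last entry was at \<open>r + 2 * k\<close>, exactly two rounds earlier.\<close>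

definition walk_invariant ::
  "(nat \<Rightarrow> nat) \<Rightarrow> port_graph \<Rightarrow> nat \<Rightarrow> nat \<Rightarrow> nat \<Rightarrow> agent_state \<times> agent_state \<Rightarrow> bool"
where
  "walk_invariant x P v w k S \<longleftrightarrow>
     (\<exists>u p h h' r r'. S = (\<lparr>pos = u, hist = h\<rparr>, \<lparr>pos = w, hist = h'\<rparr>) \<and>
        exp_walk x P v k = (u, p) \<and> walker r h \<and> length h = r + 1 + 2 * k \<and> waiter r' h' \<and>
        (k > 0 \<longrightarrow> entered (obs h (r + 2 * k)) = Some (deg P u, p)) \<and>
        \<not> stopped \<lparr>pos = u, hist = h\<rparr> \<and> \<not> stopped \<lparr>pos = w, hist = h'\<rparr> \<and>
        moves \<lparr>pos = u, hist = h\<rparr> = k \<and> moves \<lparr>pos = w, hist = h'\<rparr> = 0)"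

lemma stopped_append [simp]:
  "stopped \<lparr>pos = u, hist = h @ h'\<rparr> \<longleftrightarrow> stopped \<lparr>pos = u, hist = h\<rparr> \<or> (\<exists>e\<in>set h'. declares (act e))"
  by (auto simp: stopped_def)

lemma stopped_pos: "stopped \<lparr>pos = u, hist = h\<rparr> = stopped \<lparr>pos = v, hist = h\<rparr>"
  by (simp add: stopped_def)

text \<open>The walker moves and beeps, and the waiter hears this loudly exactly if the walker has
  arrived. In that case the waiter's beep in the next round is loud for the now listening walker,
  and both declare in round \<open>t + 2\<close>. Otherwise the second round is silent and the walk
  continues.\<close>

lemma walk_two_rounds:
  fixes x R :: "nat \<Rightarrow> nat" and n :: nat
  defines "alg \<equiv> fast_rv x R n"
  assumes graph: "is_port_graph P" "v \<in> nodes P" and k: "k < R n"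
    and awake: "wake A \<le> t" "wake B \<le> t"
    and inv: "walk_invariant x P v w k (run alg P A B t)"
  shows "if fst (exp_walk x P v (Suc k)) = w
    then rendezvous_at alg P A B (t + 2) \<and>
      moves (fst (run alg P A B (t + 2))) = Suc k \<and> moves (snd (run alg P A B (t + 2))) = 0
    else walk_invariant x P v w (Suc k) (run alg P A B (t + 2))"
proof -
  obtain u p h h' r r' where
    run: "run alg P A B t = (\<lparr>pos = u, hist = h\<rparr>, \<lparr>pos = w, hist = h'\<rparr>)" and
    walk: "exp_walk x P v k = (u, p)" and
    walker: "walker r h" and len: "length h = r + 1 + 2 * k" and
    waiter: "waiter r' h'" and
    ent: "k > 0 \<longrightarrow> entered (obs h (r + 2 * k)) = Some (deg P u, p)" and
    going: "\<not> stopped \<lparr>pos = u, hist = h\<rparr>" "\<not> stopped \<lparr>pos = w, hist = h'\<rparr>" and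
    mv: "moves \<lparr>pos = u, hist = h\<rparr> = k" "moves \<lparr>pos = w, hist = h'\<rparr> = 0"
    using inv unfolding walk_invariant_def by (elim exE conjE) (rule that)
  obtain q where q: "q < deg P u"
    and act: "modified_exploration x R n (2 * k + 1) (length h + 1) h = Action (Some q) True False"
    and next_walk: "exp_walk x P v (Suc k) = (nbr P u q, port P (nbr P u q) u)"
    using modified_exploration_move[of P v k R n x u p h "length h + 1"] graph k walk ent len by auto
  define u' where "u' = nbr P u q"
  define e where "e = Obs (Action (Some q) True False) (Some (deg P u', port P u' u)) Silence"
  define e' where "e' = Obs idle None (if u' = w then Loud else Soft)"
  have tr: "traverses P u (Action (Some q) True False)" "target P u (Action (Some q) True False) = u'"
    using q by (auto simp: traverses_def target_def u'_def)
  have acts: "alg (lbl A) d h = Action (Some q) True False" "alg (lbl B) d h' = idle" for d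
    using act len by (simp_all add: alg_def fast_rv_walker[OF walker] fast_rv_waiter[OF waiter])
  have run1: "run alg P A B (Suc t)
      = (\<lparr>pos = u', hist = h @ [e]\<rparr>, \<lparr>pos = w, hist = h' @ [e']\<rparr>)"
    using run_active_step[OF run awake going acts] tr
    by (auto simp: e_def e'_def idle_def)
  have going1: "\<not> stopped \<lparr>pos = u', hist = h @ [e]\<rparr>" "\<not> stopped \<lparr>pos = w, hist = h' @ [e']\<rparr>"
    using going stopped_pos[of u h u'] by (auto simp: e_def e'_def idle_def)
  have walker1: "walker r (h @ [e])"
    using walker by (rule walker_snoc) (simp add: e_def)
  have act1: "alg (lbl A) d (h @ [e]) = idle" for d
    using len by (simp add: alg_def fast_rv_walker[OF walker1] modified_exploration_def)
  have awake1: "wake A \<le> Suc t" "wake B \<le> Suc t" using awake by auto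
  show ?thesis
  proof (cases "u' = w")
    case True
    then have loud: "heard e' = Loud" by (simp add: e'_def)
    have act1': "alg (lbl B) d (h' @ [e']) = Action None True False" for d
      using fast_rv_waiter_loud(1)[OF waiter loud] by (simp add: alg_def)
    define f where "f = Obs idle None Loud"
    define f' where "f' = Obs (Action None True False) None Silence"
    have run2: "run alg P A B (Suc (Suc t))
        = (\<lparr>pos = w, hist = (h @ [e]) @ [f]\<rparr>, \<lparr>pos = w, hist = h' @ [e', f']\<rparr>)"
      using run_active_step[OF run1 awake1 going1 act1 act1'] True
      by (simp add: f_def f'_def idle_def)
    have going2: "\<not> stopped \<lparr>pos = w, hist = (h @ [e]) @ [f]\<rparr>" "\<not> stopped \<lparr>pos = w, hist = h' @ [e', f']\<rparr>"
      using going stopped_pos[of u h w] by (auto simp: e_def e'_def f_def f'_def idle_def)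
    have act2: "alg (lbl A) d ((h @ [e]) @ [f]) = Action None False True"
      "alg (lbl B) d (h' @ [e', f']) = Action None False True" for d
      using fast_rv_walker_loud[OF walker1, of f] fast_rv_waiter_loud(2)[OF waiter loud]
      by (simp_all add: alg_def f_def)
    have awake2: "wake A \<le> Suc (Suc t)" "wake B \<le> Suc (Suc t)" using awake by auto
    have "rendezvous_at alg P A B (Suc (Suc t))"
      unfolding rendezvous_at_def run_active_step[OF run2 awake2 going2 act2] run2
      using awake going2 act2 by (simp add: choice_def active_def)
    moreover have "moves (fst (run alg P A B (Suc (Suc t)))) = Suc k"
      "moves (snd (run alg P A B (Suc (Suc t)))) = 0"
      unfolding run2 using mv
      by (simp_all add: moves_def e_def e'_def f_def f'_def)
    ultimately show ?thesis
      using True next_walk by (simp add: u'_def del: run.simps exp_walk.simps)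
  next
    case False
    have waiter1: "waiter r' (h' @ [e'])"
      using waiter by (rule waiter_snoc) (simp add: e'_def False)
    have act1': "alg (lbl B) d (h' @ [e']) = idle" for d
      by (simp add: alg_def fast_rv_waiter[OF waiter1])
    define f where "f = Obs idle None Silence"
    have run2: "run alg P A B (Suc (Suc t))
        = (\<lparr>pos = u', hist = (h @ [e]) @ [f]\<rparr>, \<lparr>pos = w, hist = (h' @ [e']) @ [f]\<rparr>)"
      using run_active_step[OF run1 awake1 going1 act1 act1'] by (simp add: f_def idle_def)
    have "walker r ((h @ [e]) @ [f])" "waiter r' ((h' @ [e']) @ [f])"
      using walker_snoc[OF walker1, of f] waiter_snoc[OF waiter1, of f] by (simp_all add: f_def)
    moreover have "obs ((h @ [e]) @ [f]) (r + 2 * Suc k) = e"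
      using len by (simp add: obs_def nth_append)
    moreover have "\<not> stopped \<lparr>pos = u', hist = (h @ [e]) @ [f]\<rparr>"
      "\<not> stopped \<lparr>pos = w, hist = (h' @ [e']) @ [f]\<rparr>"
      using going1 by (auto simp: f_def idle_def)
    moreover have "moves \<lparr>pos = u', hist = (h @ [e]) @ [f]\<rparr> = Suc k"
      "moves \<lparr>pos = w, hist = (h' @ [e']) @ [f]\<rparr> = 0"
      using mv by (simp_all add: moves_def e_def e'_def f_def)
    ultimately have "walk_invariant x P v w (Suc k) (run alg P A B (Suc (Suc t)))"
      unfolding run2 walk_invariant_def
      using len next_walk
      by (intro exI[of _ u'] exI[of _ "port P u' u"] exI[of _ "(h @ [e]) @ [f]"]
          exI[of _ "(h' @ [e']) @ [f]"] exI[of _ r] exI[of _ r'])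
        (simp add: e_def u'_def del: exp_walk.simps)
    then show ?thesis
      using False next_walk by (simp add: u'_def del: run.simps exp_walk.simps)
  qed
qed

lemma walk_finds_waiter:
  assumes graph: "is_port_graph P" "v \<in> nodes P"
    and awake: "wake A \<le> t" "wake B \<le> t"
    and inv: "walk_invariant x P v w 0 (run (fast_rv x R n) P A B t)"
    and w: "w \<noteq> v" "w \<in> (\<lambda>i. fst (exp_walk x P v i)) ` {..R n}"
  obtains t' where "t \<le> t'" "t' \<le> t + 2 * R n" "rendezvous_at (fast_rv x R n) P A B t'"
    "moves (fst (run (fast_rv x R n) P A B t')) \<le> R n" "moves (snd (run (fast_rv x R n) P A B t')) \<le> R n"
proof -
  \<comment> \<open>\<open>K\<close> is the step of the first visit to \<open>w\<close>: all earlier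
    beeps are soft, so the invariant survives up to step \<open>K - 1\<close>.\<close>
  define K where "K = (LEAST i. fst (exp_walk x P v i) = w)"
  obtain i where i: "fst (exp_walk x P v i) = w" "i \<le> R n" using w(2) by auto
  have K: "fst (exp_walk x P v K) = w" "K \<le> R n"
    using LeastI[of "\<lambda>i. fst (exp_walk x P v i) = w" i] i
      Least_le[of "\<lambda>i. fst (exp_walk x P v i) = w" i] by (auto simp: K_def)
  have before: "fst (exp_walk x P v i) \<noteq> w" if "i < K" for i
    using not_less_Least that unfolding K_def by blast
  have "K \<noteq> 0" using K(1) w(1) by (cases K) auto
  then obtain k where k: "K = Suc k" using not0_implies_Suc by blast
  have "j \<le> k \<Longrightarrow> walk_invariant x P v w j (run (fast_rv x R n) P A B (t + 2 * j))" for j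
  proof (induction j)
    case 0
    then show ?case using inv by simp
  next
    case (Suc j)
    then show ?case
      using walk_two_rounds[OF graph, where k = j and t = "t + 2 * j" and A = A and B = B and w = w and x = x and R = R and n = n] awake K(2) k before[of "Suc j"]
      by (simp del: exp_walk.simps run.simps)
  qed
  then have "rendezvous_at (fast_rv x R n) P A B (t + 2 * k + 2) \<and>
      moves (fst (run (fast_rv x R n) P A B (t + 2 * k + 2))) = Suc k \<and>
      moves (snd (run (fast_rv x R n) P A B (t + 2 * k + 2))) = 0"
    using walk_two_rounds[OF graph, where k = k and t = "t + 2 * k" and A = A and B = B and w = w and x = x and R = R and n = n] awake K k
    by (simp del: exp_walk.simps run.simps)
  then show thesis
    using K(2) k by (intro that[of "t + 2 * k + 2"]) (auto simp del: run.simps)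
qed

text \<open>Rounds \<open>t\<close> and \<open>t + 1\<close> carry the beep and its answer, both
  made before any move. The red round \<open>t + 2\<close> brings either the declaration, for a
  common starting node, or the first step of the walk.\<close>

lemma rendezvous_after_break:
  assumes graph: "is_port_graph P" and valid: "valid_agents P A B"
    and awake: "wake A \<le> t" "wake B \<le> t"
    and agree: "\<forall>u<t. wake A \<le> u \<longrightarrow> wake B \<le> u \<longrightarrow>
      padded_nth (T2 (lbl A)) (u - wake A) = padded_nth (T2 (lbl B)) (u - wake B)"
    and listener: "\<not> padded_nth (T2 (lbl A)) (t - wake A)"
    and beeper: "padded_nth (T2 (lbl B)) (t - wake B)"
    and explore: "nodes P \<subseteq> (\<lambda>i. fst (exp_walk x P (start A) i)) ` {..R n}"
  obtains t' where "t \<le> t'" "t' \<le> t + 2 + 2 * R n" "rendezvous_at (fast_rv x R n) P A B t'"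
    "moves (fst (run (fast_rv x R n) P A B t')) \<le> R n" "moves (snd (run (fast_rv x R n) P A B t')) \<le> R n"
proof -
  define alg where "alg = fast_rv x R n"
  define m where "m = t - wake A"
  define m' where "m' = t - wake B"
  define s where "s = (if start A = start B then Loud else Soft)"
  have run0: "run alg P A B t = (\<lparr>pos = start A, hist = sb_history (lbl A) m\<rparr>,
     \<lparr>pos = start B, hist = sb_history (lbl B) m'\<rparr>)"
    using run_silent[of A B t x R n P] agree by (simp add: alg_def m_def m'_def)
  have act0: "alg (lbl A) d (sb_history (lbl A) m) = idle"
    "alg (lbl B) d (sb_history (lbl B) m') = sb_action (lbl B) m'" for d
    using listener by (simp_all add: alg_def fast_rv_sb_history sb_action_def m_def)
  have run1: "run alg P A B (Suc t) =
    (\<lparr>pos = start A, hist = sb_history (lbl A) m @ [Obs idle None s]\<rparr>,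
     \<lparr>pos = start B, hist = sb_history (lbl B) (Suc m')\<rparr>)"
    using run_active_step[OF run0 awake stopped_sb_history stopped_sb_history act0] beeper
    by (auto simp: s_def idle_def sb_action_stay sb_history_Suc m'_def)
  \<comment> \<open>In round \<open>t - 1\<close> the beeper was awake and silent, as
    \<open>T2\<close> starts silent and has no consecutive ones. By agreement the listener, if
    awake, was silent too.\<close>
  have not_before: "\<not> padded_nth (T2 (lbl A)) i" if "m = Suc i" for i
  proof -
    have i: "i = t - 1 - wake A" "wake A \<le> t - 1" "t > 0"
      using that by (auto simp: m_def)
    have "m' \<noteq> 0"
      using beeper T2_starts_silent[of "lbl B"] by (auto simp: m'_def)
    then have j: "m' = Suc (t - 1 - wake B)" "wake B \<le> t - 1"
      by (auto simp: m'_def)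
    have "\<not> padded_nth (T2 (lbl B)) (t - 1 - wake B)"
      using T2_not_consecutive[of "lbl B" "t - 1 - wake B"] beeper j(1) by (auto simp: m'_def)
    then show ?thesis
      using agree[rule_format, of "t - 1"] i j by simp
  qed
  have s: "s \<noteq> Silence" by (simp add: s_def)
  have act1: "alg (lbl A) d (sb_history (lbl A) m @ [Obs idle None s]) = Action None True False"
    "alg (lbl B) d (sb_history (lbl B) (Suc m')) = idle" for d
    using fast_rv_listener(1)[OF s not_before] T2_not_consecutive[of "lbl B" m'] beeper
    by (simp_all add: alg_def fast_rv_sb_history sb_action_def m'_def)
  have going1: "\<not> stopped \<lparr>pos = start A, hist = sb_history (lbl A) m @ [Obs idle None s]\<rparr>"
    by (simp add: stopped_sb_history idle_def)
  have awake1: "wake A \<le> Suc t" "wake B \<le> Suc t" "wake A \<le> Suc (Suc t)" "wake B \<le> Suc (Suc t)"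
    using awake by auto
  define e where "e = Obs (Action None True False) None Silence"
  have run2: "run alg P A B (Suc (Suc t)) =
    (\<lparr>pos = start A, hist = sb_history (lbl A) m @ [Obs idle None s, e]\<rparr>,
     \<lparr>pos = start B, hist = sb_history (lbl B) (Suc m') @ [Obs idle None s]\<rparr>)"
    using run_active_step[OF run1 awake1(1,2) going1 stopped_sb_history act1]
    by (auto simp: s_def e_def idle_def)
  have going2: "\<not> stopped \<lparr>pos = start A, hist = sb_history (lbl A) m @ [Obs idle None s, e]\<rparr>"
    "\<not> stopped \<lparr>pos = start B, hist = sb_history (lbl B) (Suc m') @ [Obs idle None s]\<rparr>"
    by (simp_all add: stopped_sb_history idle_def e_def)
  have moves_sb: "moves \<lparr>pos = v, hist = sb_history L j\<rparr> = 0" for v L j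
    using sb_history_quiet[of _ L j] by (auto simp: moves_def filter_empty_conv)
  have mv2: "moves \<lparr>pos = start A, hist = sb_history (lbl A) m @ [Obs idle None s, e]\<rparr> = 0"
    "moves \<lparr>pos = start B, hist = sb_history (lbl B) (Suc m') @ [Obs idle None s]\<rparr> = 0"
    using moves_sb by (simp_all add: moves_def e_def)
  have beep': "padded_nth (T2 (lbl B)) m'" using beeper by (simp add: m'_def)
  show thesis
  proof (cases "start A = start B")
    case True
    then have loud: "s = Loud" by (simp add: s_def)
    have act2: "alg (lbl A) d (sb_history (lbl A) m @ [Obs idle None s, e]) = Action None False True"
      "alg (lbl B) d (sb_history (lbl B) (Suc m') @ [Obs idle None s]) = Action None False True" for d
      using fast_rv_listener(2)[OF s not_before loud] fast_rv_beeper(1)[OF s beep' loud]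
      by (simp_all add: alg_def)
    have "rendezvous_at alg P A B (Suc (Suc t))"
      unfolding rendezvous_at_def run_active_step[OF run2 awake1(3,4) going2 act2] run2
      using awake going2 act2 True by (simp add: choice_def active_def)
    then show thesis
      using run2 mv2 that[of "Suc (Suc t)"] by (simp add: alg_def del: run.simps)
  next
    case False
    then have soft: "s = Soft" by (simp add: s_def)
    have w: "walker (m + 1) (sb_history (lbl A) m @ [Obs idle None s, e])"
      "waiter (m' + 2) (sb_history (lbl B) (Suc m') @ [Obs idle None s])"
      using fast_rv_listener(3)[OF s not_before soft] fast_rv_beeper(2)[OF s beep' soft]
      by (simp_all add: e_def)
    have "walk_invariant x P (start A) (start B) 0 (run alg P A B (Suc (Suc t)))"
      unfolding run2 walk_invariant_def
      by (intro exI[of _ "start A"] exI[of _ 0] exI[of _ "sb_history (lbl A) m @ [Obs idle None s, e]"]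
          exI[of _ "sb_history (lbl B) (Suc m') @ [Obs idle None s]"] exI[of _ "m + 1"] exI[of _ "m' + 2"])
        (use w going2 mv2 in simp)
    moreover have "start A \<in> nodes P" "start B \<in> (\<lambda>i. fst (exp_walk x P (start A) i)) ` {..R n}"
      using valid explore by (auto simp: valid_agents_def)
    ultimately obtain t' where "Suc (Suc t) \<le> t'" "t' \<le> Suc (Suc t) + 2 * R n"
      "rendezvous_at alg P A B t'" "moves (fst (run alg P A B t')) \<le> R n"
      "moves (snd (run alg P A B t')) \<le> R n"
      unfolding alg_def using walk_finds_waiter[OF graph _ awake1(3,4), where R = R and n = n and x = x] False by metis
    then show thesis
      using that[of t'] by (simp add: alg_def)
  qed
qed

section \<open>Upper bound for the complete algorithm\<close>

text \<open>Position \<open>i\<close> of the later agent's sequence faces position \<open>i\<close>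
  plus the delay in the earlier one's, so \<open>T2_shift_differs\<close> applies with the later
  agent as \<open>b\<close>. The least differing round is taken so that silence holds before
  it.\<close>

lemma first_difference:
  assumes "valid_agents P A B"
  obtains t where "wake A \<le> t" "wake B \<le> t"
    "t < max (wake A) (wake B) + 4 * lg (min (lbl A) (lbl B)) + 8"
    "padded_nth (T2 (lbl A)) (t - wake A) \<noteq> padded_nth (T2 (lbl B)) (t - wake B)"
    "\<forall>u<t. wake A \<le> u \<longrightarrow> wake B \<le> u \<longrightarrow>
      padded_nth (T2 (lbl A)) (u - wake A) = padded_nth (T2 (lbl B)) (u - wake B)"
proof -
  let ?D = "\<lambda>t. wake A \<le> t \<and> wake B \<le> t \<and>
    padded_nth (T2 (lbl A)) (t - wake A) \<noteq> padded_nth (T2 (lbl B)) (t - wake B)"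
  have pos: "lbl A > 0" "lbl B > 0" "lbl A \<noteq> lbl B"
    using assms by (auto simp: valid_agents_def)
  have lg_min: "min (lg (lbl A)) (lg (lbl B)) = lg (min (lbl A) (lbl B))"
    using lg_mono by (metis min_def nle_le)
  have "\<exists>t < max (wake A) (wake B) + 4 * lg (min (lbl A) (lbl B)) + 8. ?D t"
  proof (cases "wake A \<le> wake B")
    case True
    obtain i where "i < 4 * lg (min (lbl A) (lbl B)) + 8"
      "padded_nth (T2 (lbl B)) i \<noteq> padded_nth (T2 (lbl A)) (i + (wake B - wake A))"
      using T2_shift_differs[of "lbl A" "lbl B" "wake B - wake A"] pos lg_min by auto
    then show ?thesis
      using True by (intro exI[of _ "wake B + i"]) (simp add: add.commute)
  next
    case False
    obtain i where "i < 4 * lg (min (lbl A) (lbl B)) + 8"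
      "padded_nth (T2 (lbl A)) i \<noteq> padded_nth (T2 (lbl B)) (i + (wake A - wake B))"
      using T2_shift_differs[of "lbl B" "lbl A" "wake A - wake B"] pos lg_min
      by (auto simp: min.commute)
    then show ?thesis
      using False by (intro exI[of _ "wake A + i"]) (simp add: add.commute)
  qed
  then obtain t0 where t0: "t0 < max (wake A) (wake B) + 4 * lg (min (lbl A) (lbl B)) + 8" "?D t0"
    by blast
  define t where "t = (LEAST t. ?D t)"
  have D: "?D t"
    unfolding t_def using t0(2) by (rule LeastI)
  have "t \<le> t0"
    unfolding t_def using t0(2) by (rule Least_le)
  then have bound: "t < max (wake A) (wake B) + 4 * lg (min (lbl A) (lbl B)) + 8"
    using t0(1) by (rule le_less_trans)
  have agree: "\<forall>u<t. wake A \<le> u \<longrightarrow> wake B \<le> u \<longrightarrow>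
      padded_nth (T2 (lbl A)) (u - wake A) = padded_nth (T2 (lbl B)) (u - wake B)"
    using not_less_Least[of _ ?D] unfolding t_def by blast
  show thesis
    by (rule that[OF _ _ bound _ agree]) (use D in simp_all)
qed

text \<open>The agents differ at the latest in round \<open>4 * lg (min (lbl A) (lbl B)) + 8\<close>
  of the later agent, and at most \<open>2 + 2 * R n\<close> further rounds lead to the
  declaration.\<close>

lemma fast_rv_rendezvous:
  assumes univ: "universal_exploration x R" and graph: "is_port_graph P" "card (nodes P) \<le> n"
    and valid: "valid_agents P A B"
  shows "moves_bounded (fast_rv x R n) P A B (R n + 1)"
    and "\<exists>T. rendezvous_in_time (fast_rv x R n) P A B T \<and>
           T \<le> 4 * lg (min (lbl A) (lbl B)) + 10 + 2 * R n"
proof -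
  have valid': "valid_agents P B A"
    using valid by (auto simp: valid_agents_def)
  have explore: "nodes P \<subseteq> (\<lambda>i. fst (exp_walk x P v i)) ` {..R n}" if "v \<in> nodes P" for v
    using univ graph that by (auto simp: universal_exploration_def)
  obtain t where t: "wake A \<le> t" "wake B \<le> t"
    "t < max (wake A) (wake B) + 4 * lg (min (lbl A) (lbl B)) + 8"
    "padded_nth (T2 (lbl A)) (t - wake A) \<noteq> padded_nth (T2 (lbl B)) (t - wake B)"
    "\<forall>u<t. wake A \<le> u \<longrightarrow> wake B \<le> u \<longrightarrow>
      padded_nth (T2 (lbl A)) (u - wake A) = padded_nth (T2 (lbl B)) (u - wake B)"
    by (rule first_difference[OF valid])
  obtain t' where t': "t' \<le> t + 2 + 2 * R n" "rendezvous_at (fast_rv x R n) P A B t'"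
    "moves_bounded (fast_rv x R n) P A B (R n + 1)"
  proof (cases "padded_nth (T2 (lbl A)) (t - wake A)")
    case False
    then have beeper: "padded_nth (T2 (lbl B)) (t - wake B)" using t(4) by simp
    have "start A \<in> nodes P" using valid by (simp add: valid_agents_def)
    note explore_A = explore[OF this]
    obtain t' where t': "t \<le> t'" "t' \<le> t + 2 + 2 * R n"
      "rendezvous_at (fast_rv x R n) P A B t'"
      "moves (fst (run (fast_rv x R n) P A B t')) \<le> R n"
      "moves (snd (run (fast_rv x R n) P A B t')) \<le> R n"
      by (rule rendezvous_after_break[where x = x and R = R and n = n,
            OF graph(1) valid t(1,2,5) False beeper explore_A])
    show ?thesis
      by (rule that[OF t'(2,3) moves_bounded_rendezvous[OF t'(3-5)]])
  next
    \<comment> \<open>The second agent is now the listener, so the same lemma is applied with the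
      agents exchanged.\<close>
    case True
    then have listener: "\<not> padded_nth (T2 (lbl B)) (t - wake B)" using t(4) by simp
    have agree: "\<forall>u<t. wake B \<le> u \<longrightarrow> wake A \<le> u \<longrightarrow>
        padded_nth (T2 (lbl B)) (u - wake B) = padded_nth (T2 (lbl A)) (u - wake A)"
      using t(5) by simp
    have "start B \<in> nodes P" using valid by (simp add: valid_agents_def)
    note explore_B = explore[OF this]
    obtain t' where t': "t \<le> t'" "t' \<le> t + 2 + 2 * R n"
      "rendezvous_at (fast_rv x R n) P B A t'"
      "moves (fst (run (fast_rv x R n) P B A t')) \<le> R n"
      "moves (snd (run (fast_rv x R n) P B A t')) \<le> R n"
      by (rule rendezvous_after_break[where x = x and R = R and n = n,
            OF graph(1) valid' t(2,1) agree listener True explore_B])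
    show ?thesis
      by (rule that[OF t'(2) rendezvous_at_swap[OF t'(3)]
            moves_bounded_swap[OF moves_bounded_rendezvous[OF t'(3-5)]]])
  qed
  show "moves_bounded (fast_rv x R n) P A B (R n + 1)" by fact
  show "\<exists>T. rendezvous_in_time (fast_rv x R n) P A B T \<and>
           T \<le> 4 * lg (min (lbl A) (lbl B)) + 10 + 2 * R n"
    using t(3) t'(1,2)
    by (intro exI[of _ "t' + 1 - max (wake A) (wake B)"]) (auto simp: rendezvous_in_time_def)
qed

section \<open>Lower bound\<close>

lemma two_node_graph_simps:
  "nodes two_node_graph = {0, 1}"
  "deg two_node_graph 0 = 1" "deg two_node_graph (Suc 0) = 1"
  "nbr two_node_graph 0 0 = 1" "nbr two_node_graph (Suc 0) 0 = 0"
  "port two_node_graph v w = 0"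
  by (simp_all add: deg_def out_degree_def out_arcs_two_node_graph)
    (simp_all add: nbr_def two_node_graph_def)

text \<open>Both nodes of the two-node graph have degree 1, so the starting node does not influence
  the action.\<close>

definition solo_action :: "algorithm \<Rightarrow> nat \<Rightarrow> history \<Rightarrow> action" where
  "solo_action alg L h =
     (if \<exists>e\<in>set h. declares (act e) then Action None False False else alg L 1 h)"

text \<open>The history in the two-node graph of an agent that never hears anything.\<close>

primrec solo_history :: "algorithm \<Rightarrow> nat \<Rightarrow> nat \<Rightarrow> history" where
  "solo_history alg L 0 = []"
| "solo_history alg L (Suc t) =
     (let h = solo_history alg L t; a = solo_action alg L h in
      if \<exists>e\<in>set h. declares (act e) then h
      else h @ [Obs a (if move a = Some 0 then Some (1, 0) else None) Silence])"

text \<open>Port 0 is the only port, so these two bits are all that affects the positions and what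
  the other agent hears. Their four combinations give the base 4 in the counting.\<close>

definition solo_behaviour :: "algorithm \<Rightarrow> nat \<Rightarrow> nat \<Rightarrow> bool \<times> bool" where
  "solo_behaviour alg L t =
     (let a = solo_action alg L (solo_history alg L t) in (move a = Some 0, beeps a))"

text \<open>With equal behaviour both agents beep or neither does, so nothing is heard wherever the
  other agent is; hence \<open>w\<close> is arbitrary.\<close>

lemma step_two_node_graph:
  assumes "wake A = 0" "wake B = 0" "start A \<in> {0, 1}" "start B \<in> {0, 1}" "u \<in> {0, 1}"
    and "solo_behaviour alg (lbl A) t = solo_behaviour alg (lbl B) t"
  shows "step alg two_node_graph t A \<lparr>pos = u, hist = solo_history alg (lbl A) t\<rparr>
       B \<lparr>pos = w, hist = solo_history alg (lbl B) t\<rparr>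
     = \<lparr>pos = if fst (solo_behaviour alg (lbl A) t) then 1 - u else u,
        hist = solo_history alg (lbl A) (Suc t)\<rparr>"
proof -
  let ?a = "solo_action alg (lbl A) (solo_history alg (lbl A) t)"
  let ?b = "solo_action alg (lbl B) (solo_history alg (lbl B) t)"
  have "choice alg two_node_graph t C \<lparr>pos = v, hist = h\<rparr> = solo_action alg (lbl C) h"
    if "wake C = 0" "start C \<in> {0, 1}" for C h v
    using that by (auto simp: choice_def active_def stopped_def solo_action_def two_node_graph_simps)
  then have choices:
    "choice alg two_node_graph t A \<lparr>pos = u, hist = solo_history alg (lbl A) t\<rparr> = ?a"
    "choice alg two_node_graph t B \<lparr>pos = w, hist = solo_history alg (lbl B) t\<rparr> = ?b"
    using assms by auto
  have behaviour: "fst (solo_behaviour alg (lbl A) t) \<longleftrightarrow> move ?a = Some 0" "beeps ?a \<longleftrightarrow> beeps ?b"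
    using assms(6) by (simp_all add: solo_behaviour_def Let_def)
  have traverses: "traverses two_node_graph u ?a \<longleftrightarrow> move ?a = Some 0"
    using assms(5) by (auto simp: traverses_def two_node_graph_simps)
  have target: "target two_node_graph u ?a = (if move ?a = Some 0 then 1 - u else u)"
    unfolding target_def traverses using assms(5) by (auto simp: two_node_graph_simps)
  have degree: "deg two_node_graph (1 - u) = 1"
    using assms(5) by (auto simp: two_node_graph_simps)
  show ?thesis
  proof (cases "\<exists>e\<in>set (solo_history alg (lbl A) t). declares (act e)")
    case True
    then show ?thesis
      unfolding behaviour by (simp add: step_def active_def stopped_def solo_action_def)
  next
    case False
    then show ?thesis
      unfolding step_def choices Let_def behaviour
      using assms(1) behaviour(2) degree
      by (simp add: active_def stopped_def two_node_graph_simps Let_def target traverses)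
  qed
qed

text \<open>Moving in the same rounds, the agents exchange nodes and remain at opposite ends of the
  edge.\<close>

lemma solo_behaviour_no_meeting:
  assumes "wake A = 0" "wake B = 0" "start A = 0" "start B = 1"
    and "\<And>u. u < t \<Longrightarrow> solo_behaviour alg (lbl A) u = solo_behaviour alg (lbl B) u"
  shows "\<exists>u\<in>{0, 1}. run alg two_node_graph A B t =
    (\<lparr>pos = u, hist = solo_history alg (lbl A) t\<rparr>, \<lparr>pos = 1 - u, hist = solo_history alg (lbl B) t\<rparr>)"
  using assms(5)
proof (induction t)
  case 0
  then show ?case using assms by simp
next
  case (Suc t)
  then obtain u where u: "u \<in> {0, 1}" and run: "run alg two_node_graph A B t =
    (\<lparr>pos = u, hist = solo_history alg (lbl A) t\<rparr>, \<lparr>pos = 1 - u, hist = solo_history alg (lbl B) t\<rparr>)"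
    by auto
  let ?u = "if fst (solo_behaviour alg (lbl A) t) then 1 - u else u"
  have next_run: "run alg two_node_graph A B (Suc t) =
    (\<lparr>pos = ?u, hist = solo_history alg (lbl A) (Suc t)\<rparr>,
     \<lparr>pos = 1 - ?u, hist = solo_history alg (lbl B) (Suc t)\<rparr>)"
    using run step_two_node_graph[of A B u alg t "1 - u"] step_two_node_graph[of B A "1 - u" alg t u]
      Suc.prems[of t] assms u by (auto simp del: solo_history.simps)
  show ?case
  proof (rule bexI[of _ ?u])
    show "?u \<in> {0, 1}" using u by auto
  qed (rule next_run)
qed

lemma slow_pair:
  assumes alg: "rendezvous_algorithm alg two_node_graph" and k: "k \<ge> 1"
  obtains A B T where "valid_agents two_node_graph A B" "2 ^ k \<le> min (lbl A) (lbl B)"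
    "min (lbl A) (lbl B) < 2 ^ Suc k" "rendezvous_in_time alg two_node_graph A B T" "k \<le> 2 * T"
proof -
  \<comment> \<open>The largest \<open>m\<close> with \<open>4 ^ m < 2 ^ k\<close>, where
    \<open>2 ^ k\<close> is the number of labels of length \<open>k + 1\<close>.\<close>
  define m where "m = (k - 1) div 2"
  define f where "f L = map (solo_behaviour alg L) [0..<m]" for L
  let ?L = "{2 ^ k..<2 ^ Suc k} :: nat set"
  have "f ` ?L \<subseteq> {xs. set xs \<subseteq> (UNIV :: (bool \<times> bool) set) \<and> length xs = m}"
    by (auto simp: f_def)
  then have "card (f ` ?L) \<le> card {xs. set xs \<subseteq> (UNIV :: (bool \<times> bool) set) \<and> length xs = m}"
    by (intro card_mono finite_lists_length_eq) auto
  also have "\<dots> = 4 ^ m"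
    by (subst card_lists_length_eq) (auto simp: card_UNIV_bool simp flip: UNIV_Times_UNIV)
  also have "(4 :: nat) ^ m = 2 ^ (2 * m)"
    by (simp add: power_mult)
  also have "\<dots> < 2 ^ k"
    using k by (intro power_strict_increasing) (auto simp: m_def)
  also have "2 ^ k = card ?L"
    by simp
  finally have "\<not> inj_on f ?L"
    by (rule pigeonhole)
  then obtain l l' where l: "l \<in> ?L" "l' \<in> ?L" "l \<noteq> l'" and eq: "f l = f l'"
    by (auto simp: inj_on_def)
  define A where "A = \<lparr>lbl = l, start = 0, wake = 0\<rparr>"
  define B where "B = \<lparr>lbl = l', start = 1, wake = 0\<rparr>"
  have "l > 0" "l' > 0"
    using l by (auto intro: Nat.gr0I)
  then have valid: "valid_agents two_node_graph A B"
    using l by (simp add: valid_agents_def A_def B_def two_node_graph_simps)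
  then obtain T where T: "rendezvous_in_time alg two_node_graph A B T"
    using alg by (auto simp: rendezvous_algorithm_def)
  then obtain t where t: "rendezvous_at alg two_node_graph A B t" "T = t + 1"
    by (auto simp: rendezvous_in_time_def A_def B_def)
  have "solo_behaviour alg l u = solo_behaviour alg l' u" if "u < m" for u
    using eq that by (simp add: f_def)
  then have "pos (fst (run alg two_node_graph A B (Suc t))) \<noteq> pos (snd (run alg two_node_graph A B (Suc t)))"
    if "Suc t \<le> m"
    using that solo_behaviour_no_meeting[of A B "Suc t" alg]
    by (fastforce simp: A_def B_def simp del: run.simps)
  \<comment> \<open>A rendezvous at \<open>t\<close> needs equal positions after
    \<open>Suc t\<close> rounds, which are impossible while \<open>Suc t \<le> m\<close>.\<close>
  then have "m < T"
    using t by (force simp: rendezvous_at_def not_le[symmetric] simp del: run.simps)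
  then have "k \<le> 2 * T"
    using k by (auto simp: m_def)
  moreover have "2 ^ k \<le> min (lbl A) (lbl B)" "min (lbl A) (lbl B) < 2 ^ Suc k"
    using l by (auto simp: A_def B_def)
  ultimately show thesis
    using that[OF valid _ _ T] by blast
qed

theorem theorem4p3:
  shows
    "(\<forall>x R. universal_exploration x R \<longrightarrow>
        (\<forall>n\<ge>2. \<exists>c>0. \<exists>C :: real.
           \<forall>P A B. is_port_graph P \<and> card (nodes P) \<le> n \<and> valid_agents P A B \<longrightarrow>
             moves_bounded (fast_rv x R n) P A B c \<and>
             (\<exists>T. rendezvous_in_time (fast_rv x R n) P A B T \<and>
                  real T \<le> C * real (lg (min (lbl A) (lbl B))))))
     \<and>
     (\<exists>\<kappa> :: real. \<kappa> > 0 \<and>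
        (\<forall>alg. rendezvous_algorithm alg two_node_graph \<longrightarrow>
           infinite {l. \<exists>A B T. valid_agents two_node_graph A B \<and> min (lbl A) (lbl B) = l \<and>
                          rendezvous_in_time alg two_node_graph A B T \<and>
                          real T \<ge> \<kappa> * real (lg l)}))"
proof (intro conjI allI impI)
  fix x R and n :: nat
  assume univ: "universal_exploration x R"
  show "\<exists>c>0. \<exists>C :: real.
          \<forall>P A B. is_port_graph P \<and> card (nodes P) \<le> n \<and> valid_agents P A B \<longrightarrow>
            moves_bounded (fast_rv x R n) P A B c \<and>
            (\<exists>T. rendezvous_in_time (fast_rv x R n) P A B T \<and>
                 real T \<le> C * real (lg (min (lbl A) (lbl B))))"
  \<comment> \<open>Since \<open>lg\<close> is at least 1 on positive labels, the additive
    \<open>10 + 2 * R n\<close> is absorbed into the factor: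
    \<open>4 + (10 + 2 * R n)\<close>.\<close>
  proof (rule exI[of _ "R n + 1"], rule conjI, simp, rule exI[of _ "real (14 + 2 * R n)"],
      intro allI impI, elim conjE)
    fix P A B
    assume P: "is_port_graph P" "card (nodes P) \<le> n" and valid: "valid_agents P A B"
    let ?l = "lg (min (lbl A) (lbl B))"
    obtain T where T: "rendezvous_in_time (fast_rv x R n) P A B T" "T \<le> 4 * ?l + (10 + 2 * R n)"
      using fast_rv_rendezvous(2)[OF univ P valid] by (auto simp: add.assoc)
    have "?l \<ge> 1"
      using lg_pos[of "min (lbl A) (lbl B)"] valid by (simp add: valid_agents_def)
    then have "(10 + 2 * R n) * 1 \<le> (10 + 2 * R n) * ?l"
      by (rule mult_le_mono2)
    then have "T \<le> (14 + 2 * R n) * ?l"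
      using T(2) by (simp add: distrib_right)
    then have "real T \<le> real (14 + 2 * R n) * real ?l"
      by (metis of_nat_le_iff of_nat_mult)
    then show "moves_bounded (fast_rv x R n) P A B (R n + 1) \<and>
        (\<exists>T. rendezvous_in_time (fast_rv x R n) P A B T \<and> real T \<le> real (14 + 2 * R n) * real ?l)"
      using T(1) fast_rv_rendezvous(1)[OF univ P valid] by blast
  qed
next
  show "\<exists>\<kappa> :: real. \<kappa> > 0 \<and>
        (\<forall>alg. rendezvous_algorithm alg two_node_graph \<longrightarrow>
           infinite {l. \<exists>A B T. valid_agents two_node_graph A B \<and> min (lbl A) (lbl B) = l \<and>
                          rendezvous_in_time alg two_node_graph A B T \<and>
                          real T \<ge> \<kappa> * real (lg l)})"
  \<comment> \<open>For labels of length \<open>k + 1\<close> with \<open>k \<ge> 1\<close>,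
    \<open>slow_pair\<close> gives \<open>k + 1 \<le> 2 * k \<le> 4 * T\<close>, whence the constant
    1/4.\<close>
  proof (rule exI[of _ "1 / 4"], intro conjI allI impI)
    fix alg
    assume alg: "rendezvous_algorithm alg two_node_graph"
    let ?slow = "{l. \<exists>A B T. valid_agents two_node_graph A B \<and> min (lbl A) (lbl B) = l \<and>
                          rendezvous_in_time alg two_node_graph A B T \<and>
                          real T \<ge> 1 / 4 * real (lg l)}"
    show "infinite ?slow"
      unfolding infinite_nat_iff_unbounded
    proof
      fix m
      obtain A B T where AB: "valid_agents two_node_graph A B" "2 ^ Suc m \<le> min (lbl A) (lbl B)"
        "min (lbl A) (lbl B) < 2 ^ Suc (Suc m)" "rendezvous_in_time alg two_node_graph A B T"
        "Suc m \<le> 2 * T"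
        by (rule slow_pair[OF alg, of "Suc m"]) simp_all
      have "lg (min (lbl A) (lbl B)) = Suc m + 1"
        using AB(2,3) by (rule lg_eqI)
      then have "real T \<ge> 1 / 4 * real (lg (min (lbl A) (lbl B)))"
        using AB(5) by simp
      then have "min (lbl A) (lbl B) \<in> ?slow"
        using AB(1,4) by blast
      moreover have "m < min (lbl A) (lbl B)"
        using AB(2) less_exp[of "Suc m"] by linarith
      ultimately show "\<exists>l>m. l \<in> ?slow"
        by blast
    qed
  qed simp
qed

end
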